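(* Let $(\mathscr{C},\mathbf{W})$ satisfy conditions (BF), fix a set of choices $\mathrm{C}(\mathbf{W})$, and let $\mathscr{C}[\mathbf{W}^{-1}]$ be the bicategory of fractions induced by such choices. Let $\underline f^m=(A^m,w^m,f^m):A\to B$ for $m=1,2$ be morphisms in $\mathscr{C}[\mathbf{W}^{-1}]$ and let $(E,p,q,\varsigma)$ be the fixed choice in $\mathrm{C}(\mathbf{W})$ for the pair $(w^1,w^2)$. Then there is a natural bijection between the set of $\sim$-equivalence classes $[A^3,t,\varphi]$ of almost canonical representatives from $\underline f^1$ to $\underline f^2$ and the set of 2-morphisms $\underline f^1\Rightarrow\underline f^2$ of $\mathscr{C}[\mathbf{W}^{-1}]$ in the sense of Pronk, given by $$\mathcal N:\ [A^3,t,\varphi]\mapsto[A^3,\,p\circ t,\,q\circ t,\,\varsigma\circ t,\,\varphi].$$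
   Context: Conventions. $\mathscr{C}$ is a bicategory and $\mathbf{W}$ a class of 1-morphisms in it. $\circ$ denotes composition of 1-morphisms and whiskering; $\bullet$ denotes vertical composition of 2-morphisms ($\beta\bullet\alpha$ means first $\alpha$, then $\beta$). Associators and unitors of $\mathscr{C}$ are omitted from the notation, as if $\mathscr{C}$ were a 2-category (by coherence they can be inserted unambiguously); the statement is meant for arbitrary bicategories. Conditions (BF): (BF1) every $\mathrm{id}_A$ is in $\mathbf{W}$. (BF2) $\mathbf{W}$ is closed under composition. (BF3) For every $w:A\to B$ in $\mathbf{W}$ and every $f:C\to B$ there are an object $D$, $w':D\to C$ in $\mathbf{W}$, $f':D\to A$ and an invertible 2-morphism $f\circ w'\Rightarrow w\circ f'$. (BF4a) For every $w:B\to A$ in $\mathbf{W}$, $f^1,f^2:C\to B$ and $\alpha:w\circ f^1\Rightarrow w\circ f^2$ there are an object $D$, $v:D\to C$ in $\mathbf{W}$ and $\beta:f^1\circ v\Rightarrow f^2\circ v$ with $\alpha\circ v=w\circ\beta$. (BF4b) If $\alpha$ in (BF4a) is invertible, so is $\beta$. (BF4c) If $(D',v',\beta')$ is another triple with the same properties as $(D,v,\beta)$ in (BF4a), there are an object $E$, $u:E\to D$, $u':E\to D'$ and an invertible $\zeta:v\circ u\Rightarrow v'\circ u'$ with $v\circ u\in\mathbf{W}$ and $(\beta'\circ u')\bullet(f^1\circ\zeta)=(f^2\circ\zeta)\bullet(\beta\circ u)$. (BF5) If $w:A\to B$ is in $\mathbf{W}$ and there is an invertible $v\Rightarrow w$,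 then $v\in\mathbf{W}$. $\mathrm{C}(\mathbf{W})$: for every $f:A'\to B$ and $v:B'\to B$ in $\mathbf{W}$, a chosen $(A'',v',f',\rho)$ with $v':A''\to A'$ in $\mathbf{W}$, $f':A''\to B'$, $\rho:f\circ v'\Rightarrow v\circ f'$ invertible. In particular the choice $(E,p,q,\varsigma)$ for $(w^1,w^2)$, where $w^1:A^1\to A$, $w^2:A^2\to A$ are in $\mathbf{W}$, consists of $p:E\to A^1$ in $\mathbf{W}$, $q:E\to A^2$ and an invertible $\varsigma:w^1\circ p\Rightarrow w^2\circ q$. Bicategory of fractions $\mathscr{C}[\mathbf{W}^{-1}]$ (Pronk). Objects: those of $\mathscr{C}$. A morphism $A\to B$ is a triple $(A',w,f)$ with $w:A'\to A$ in $\mathbf{W}$, $f:A'\to B$. A 2-morphism $(A^1,w^1,f^1)\Rightarrow(A^2,w^2,f^2)$ (both $A\to B$) in the sense of Pronk is an equivalence class $[A^3,v^1,v^2,\alpha,\beta]$ of data with $v^m:A^3\to A^m$, $w^1\circ v^1\in\mathbf{W}$, $\alpha:w^1\circ v^1\Rightarrow w^2\circ v^2$ invertible, $\beta:f^1\circ v^1\Rightarrow f^2\circ v^2$; $(A^3,v^1,v^2,\alpha,\beta)$ and $(A'^3,v'^1,v'^2,\alpha',\beta')$ are equivalent iff there are $z:A^4\to A^3$, $z':A^4\to A'^3$ and invertible $\sigma^1:v'^1\circ z'\Rightarrow v^1\circ z$, $\sigma^2:v^2\circ z\Rightarrow v'^2\circ z'$ with $w^1\circ v^1\circ z\in\mathbf{W}$,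 $(w^2\circ\sigma^2)\bullet(\alpha\circ z)\bullet(w^1\circ\sigma^1)=\alpha'\circ z'$ and $(f^2\circ\sigma^2)\bullet(\beta\circ z)\bullet(f^1\circ\sigma^1)=\beta'\circ z'$. Almost canonical representatives. An almost canonical representative of a 2-morphism from $\underline f^1$ to $\underline f^2$ is a triple $(A^3,t,\varphi)$ with $t:A^3\to E$ in $\mathbf{W}$ and $\varphi:f^1\circ p\circ t\Rightarrow f^2\circ q\circ t$ a 2-morphism in $\mathscr{C}$. One sets $(A^3,t,\varphi)\sim(A'^3,t',\varphi')$ iff there are an object $A^4$, a morphism $u:A^4\to A^3$ in $\mathbf{W}$, a morphism $u':A^4\to A'^3$ and an invertible 2-morphism $\sigma:t'\circ u'\Rightarrow t\circ u$ such that $(f^2\circ q\circ\sigma^{-1})\bullet(\varphi\circ u)\bullet(f^1\circ p\circ\sigma)=\varphi'\circ u'$. This is an equivalence relation; $[A^3,t,\varphi]$ denotes the class. *)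

theory Defs
  imports Main
begin

section \<open>Bicategories\<close>

text \<open>
  Objects, 1-morphisms and 2-morphisms are carrier sets inside three types; the operations are total
  functions constrained only on composable arguments. Composition is written in application order:
  \<open>g \<odot> f\<close> and \<open>\<beta> \<bullet> \<alpha>\<close> mean first \<open>f\<close>, then \<open>g\<close>, resp. first \<open>\<alpha>\<close>, then \<open>\<beta>\<close>.
\<close>

record ('o, 'm, 'c) bicat =
  obj :: "'o set"
  mor :: "'m set"
  cell :: "'c set"
  src :: "'m \<Rightarrow> 'o"
  trg :: "'m \<Rightarrow> 'o"
  dom2 :: "'c \<Rightarrow> 'm"
  cod2 :: "'c \<Rightarrow> 'm"
  id1 :: "'o \<Rightarrow> 'm"
  id2 :: "'m \<Rightarrow> 'c"
  comp1 :: "'m \<Rightarrow> 'm \<Rightarrow> 'm" (infixl "\<odot>\<index>" 75)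
  vcomp :: "'c \<Rightarrow> 'c \<Rightarrow> 'c" (infixl "\<bullet>\<index>" 65)
  hcomp :: "'c \<Rightarrow> 'c \<Rightarrow> 'c" (infixl "\<star>\<index>" 70)
  assoc :: "'m \<Rightarrow> 'm \<Rightarrow> 'm \<Rightarrow> 'c"
  lunit :: "'m \<Rightarrow> 'c"
  runit :: "'m \<Rightarrow> 'c"

definition hom :: "('o, 'm, 'c) bicat \<Rightarrow> 'o \<Rightarrow> 'o \<Rightarrow> 'm set" where
  "hom C A B = {f \<in> mor C. src C f = A \<and> trg C f = B}"

definition hom2 :: "('o, 'm, 'c) bicat \<Rightarrow> 'm \<Rightarrow> 'm \<Rightarrow> 'c set" where
  "hom2 C f g = {\<alpha> \<in> cell C. dom2 C \<alpha> = f \<and> cod2 C \<alpha> = g}"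

definition inverse2 :: "('o, 'm, 'c) bicat \<Rightarrow> 'c \<Rightarrow> 'c \<Rightarrow> bool" where
  "inverse2 C \<alpha> \<beta> \<longleftrightarrow>
    \<alpha> \<in> cell C \<and> \<beta> \<in> hom2 C (cod2 C \<alpha>) (dom2 C \<alpha>) \<and>
    \<beta> \<bullet>\<^bsub>C\<^esub> \<alpha> = id2 C (dom2 C \<alpha>) \<and> \<alpha> \<bullet>\<^bsub>C\<^esub> \<beta> = id2 C (cod2 C \<alpha>)"

definition iso2 :: "('o, 'm, 'c) bicat \<Rightarrow> 'm \<Rightarrow> 'm \<Rightarrow> 'c set" where
  "iso2 C f g = {\<alpha> \<in> hom2 C f g. \<exists>\<beta>. inverse2 C \<alpha> \<beta>}"

definition inv2 :: "('o, 'm, 'c) bicat \<Rightarrow> 'c \<Rightarrow> 'c" where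
  "inv2 C \<alpha> = (THE \<beta>. inverse2 C \<alpha> \<beta>)"

definition lwhisker :: "('o, 'm, 'c) bicat \<Rightarrow> 'm \<Rightarrow> 'c \<Rightarrow> 'c" (infixr "\<triangleright>\<index>" 72) where
  "f \<triangleright>\<^bsub>C\<^esub> \<alpha> = id2 C f \<star>\<^bsub>C\<^esub> \<alpha>"

definition rwhisker :: "('o, 'm, 'c) bicat \<Rightarrow> 'c \<Rightarrow> 'm \<Rightarrow> 'c" (infixl "\<triangleleft>\<index>" 72) where
  "\<alpha> \<triangleleft>\<^bsub>C\<^esub> f = \<alpha> \<star>\<^bsub>C\<^esub> id2 C f"

locale bicategory =
  fixes C :: "('o, 'm, 'c) bicat" (structure)
  assumes src_obj: "f \<in> mor C \<Longrightarrow> src C f \<in> obj C"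
    and trg_obj: "f \<in> mor C \<Longrightarrow> trg C f \<in> obj C"
    and dom2_mor: "\<alpha> \<in> cell C \<Longrightarrow> dom2 C \<alpha> \<in> mor C"
    and cod2_mor: "\<alpha> \<in> cell C \<Longrightarrow> cod2 C \<alpha> \<in> mor C"
    and src_parallel: "\<alpha> \<in> cell C \<Longrightarrow> src C (dom2 C \<alpha>) = src C (cod2 C \<alpha>)"
    and trg_parallel: "\<alpha> \<in> cell C \<Longrightarrow> trg C (dom2 C \<alpha>) = trg C (cod2 C \<alpha>)"
    and id1_hom: "A \<in> obj C \<Longrightarrow> id1 C A \<in> hom C A A"
    and comp1_hom: "f \<in> hom C X Y \<Longrightarrow> g \<in> hom C Y Z \<Longrightarrow> g \<odot> f \<in> hom C X Z"
    and id2_hom2: "f \<in> mor C \<Longrightarrow> id2 C f \<in> hom2 C f f"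
    and vcomp_hom2: "\<alpha> \<in> hom2 C f g \<Longrightarrow> \<beta> \<in> hom2 C g h \<Longrightarrow> \<beta> \<bullet> \<alpha> \<in> hom2 C f h"
    and vcomp_id_left: "\<alpha> \<in> hom2 C f g \<Longrightarrow> id2 C g \<bullet> \<alpha> = \<alpha>"
    and vcomp_id_right: "\<alpha> \<in> hom2 C f g \<Longrightarrow> \<alpha> \<bullet> id2 C f = \<alpha>"
    and vcomp_assoc: "\<alpha> \<in> hom2 C f g \<Longrightarrow> \<beta> \<in> hom2 C g h \<Longrightarrow> \<gamma> \<in> hom2 C h k \<Longrightarrow>
      (\<gamma> \<bullet> \<beta>) \<bullet> \<alpha> = \<gamma> \<bullet> (\<beta> \<bullet> \<alpha>)"
    and hcomp_hom2: "\<alpha> \<in> hom2 C f f' \<Longrightarrow> \<beta> \<in> hom2 C g g' \<Longrightarrow> src C g = trg C f \<Longrightarrow>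
      \<beta> \<star> \<alpha> \<in> hom2 C (g \<odot> f) (g' \<odot> f')"
    and hcomp_id: "f \<in> hom C X Y \<Longrightarrow> g \<in> hom C Y Z \<Longrightarrow> id2 C g \<star> id2 C f = id2 C (g \<odot> f)"
    and interchange: "\<alpha> \<in> hom2 C f f' \<Longrightarrow> \<alpha>' \<in> hom2 C f' f'' \<Longrightarrow>
      \<beta> \<in> hom2 C g g' \<Longrightarrow> \<beta>' \<in> hom2 C g' g'' \<Longrightarrow> src C g = trg C f \<Longrightarrow>
      (\<beta>' \<bullet> \<beta>) \<star> (\<alpha>' \<bullet> \<alpha>) = (\<beta>' \<star> \<alpha>') \<bullet> (\<beta> \<star> \<alpha>)"
    and assoc_iso2: "f \<in> hom C X Y \<Longrightarrow> g \<in> hom C Y Z \<Longrightarrow> h \<in> hom C Z V \<Longrightarrow>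
      assoc C h g f \<in> iso2 C ((h \<odot> g) \<odot> f) (h \<odot> (g \<odot> f))"
    and assoc_natural: "\<alpha> \<in> hom2 C f f' \<Longrightarrow> \<beta> \<in> hom2 C g g' \<Longrightarrow> \<gamma> \<in> hom2 C h h' \<Longrightarrow>
      src C g = trg C f \<Longrightarrow> src C h = trg C g \<Longrightarrow>
      assoc C h' g' f' \<bullet> ((\<gamma> \<star> \<beta>) \<star> \<alpha>) = (\<gamma> \<star> (\<beta> \<star> \<alpha>)) \<bullet> assoc C h g f"
    and lunit_iso2: "f \<in> hom C X Y \<Longrightarrow> lunit C f \<in> iso2 C (id1 C Y \<odot> f) f"
    and lunit_natural: "\<alpha> \<in> hom2 C f g \<Longrightarrow>
      lunit C g \<bullet> (id1 C (trg C f) \<triangleright> \<alpha>) = \<alpha> \<bullet> lunit C f"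
    and runit_iso2: "f \<in> hom C X Y \<Longrightarrow> runit C f \<in> iso2 C (f \<odot> id1 C X) f"
    and runit_natural: "\<alpha> \<in> hom2 C f g \<Longrightarrow>
      runit C g \<bullet> (\<alpha> \<triangleleft> id1 C (src C f)) = \<alpha> \<bullet> runit C f"
    and pentagon: "f \<in> hom C X Y \<Longrightarrow> g \<in> hom C Y Z \<Longrightarrow> h \<in> hom C Z V \<Longrightarrow> k \<in> hom C V U \<Longrightarrow>
      (k \<triangleright> assoc C h g f) \<bullet> assoc C k (h \<odot> g) f \<bullet> (assoc C k h g \<triangleleft> f) =
      assoc C k h (g \<odot> f) \<bullet> assoc C (k \<odot> h) g f"
    and triangle: "f \<in> hom C X Y \<Longrightarrow> g \<in> hom C Y Z \<Longrightarrow>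
      (g \<triangleright> lunit C f) \<bullet> assoc C g (id1 C Y) f = runit C g \<triangleleft> f"

text \<open>
  Whiskering of composites with the associators inserted, all composites being bracketed to the
  right, resp. to the left:
  for \<open>\<beta> : f \<odot> v \<Rightarrow> g \<odot> w\<close>, \<open>rwhisker_assoc C f v g w \<beta> u : f \<odot> (v \<odot> u) \<Rightarrow> g \<odot> (w \<odot> u)\<close>;
  for \<open>\<sigma> : t \<odot> u \<Rightarrow> t' \<odot> u'\<close>, \<open>lwhisker_assoc C p t u t' u' \<sigma> : (p \<odot> t) \<odot> u \<Rightarrow> (p \<odot> t') \<odot> u'\<close>.
\<close>

definition rwhisker_assoc :: "('o, 'm, 'c) bicat \<Rightarrow> 'm \<Rightarrow> 'm \<Rightarrow> 'm \<Rightarrow> 'm \<Rightarrow> 'c \<Rightarrow> 'm \<Rightarrow> 'c" where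
  "rwhisker_assoc C f v g w \<beta> u =
    assoc C g w u \<bullet>\<^bsub>C\<^esub> (\<beta> \<triangleleft>\<^bsub>C\<^esub> u) \<bullet>\<^bsub>C\<^esub> inv2 C (assoc C f v u)"

definition lwhisker_assoc ::
  "('o, 'm, 'c) bicat \<Rightarrow> 'm \<Rightarrow> 'm \<Rightarrow> 'm \<Rightarrow> 'm \<Rightarrow> 'm \<Rightarrow> 'c \<Rightarrow> 'c" where
  "lwhisker_assoc C p t u t' u' \<sigma> =
    inv2 C (assoc C p t' u') \<bullet>\<^bsub>C\<^esub> (p \<triangleright>\<^bsub>C\<^esub> \<sigma>) \<bullet>\<^bsub>C\<^esub> assoc C p t u"

section \<open>Conditions (BF) and choices\<close>

text \<open>
  In (BF4) the triple is required to exist, with \<open>\<beta>\<close> invertible when \<open>\<alpha>\<close> is; it is not demanded that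
  every \<open>\<beta>\<close> over an invertible \<open>\<alpha>\<close> is invertible. (BF4c) compares any two triples as in (BF4a).
\<close>

definition BF4_triple ::
  "('o, 'm, 'c) bicat \<Rightarrow> 'm set \<Rightarrow> 'm \<Rightarrow> 'm \<Rightarrow> 'm \<Rightarrow> 'c \<Rightarrow> 'o \<Rightarrow> 'm \<Rightarrow> 'c \<Rightarrow> bool" where
  "BF4_triple C W w f1 f2 \<alpha> D v \<beta> \<longleftrightarrow>
    v \<in> W \<and> v \<in> hom C D (src C f1) \<and> \<beta> \<in> hom2 C (f1 \<odot>\<^bsub>C\<^esub> v) (f2 \<odot>\<^bsub>C\<^esub> v) \<and>
    rwhisker_assoc C w f1 w f2 \<alpha> v = w \<triangleright>\<^bsub>C\<^esub> \<beta>"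

locale bicategory_BF = bicategory C for C :: "('o, 'm, 'c) bicat" (structure) +
  fixes W :: "'m set"
  assumes W_mor: "W \<subseteq> mor C"
    and BF1: "A \<in> obj C \<Longrightarrow> id1 C A \<in> W"
    and BF2: "v \<in> W \<Longrightarrow> w \<in> W \<Longrightarrow> src C w = trg C v \<Longrightarrow> w \<odot> v \<in> W"
    and BF3: "w \<in> W \<Longrightarrow> w \<in> hom C A B \<Longrightarrow> f \<in> hom C X B \<Longrightarrow>
      \<exists>D w' f' \<rho>. w' \<in> W \<and> w' \<in> hom C D X \<and> f' \<in> hom C D A \<and> \<rho> \<in> iso2 C (f \<odot> w') (w \<odot> f')"
    and BF4ab: "w \<in> W \<Longrightarrow> w \<in> hom C B A \<Longrightarrow> f1 \<in> hom C X B \<Longrightarrow> f2 \<in> hom C X B \<Longrightarrow>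
      \<alpha> \<in> hom2 C (w \<odot> f1) (w \<odot> f2) \<Longrightarrow>
      \<exists>D v \<beta>. BF4_triple C W w f1 f2 \<alpha> D v \<beta> \<and>
        (\<alpha> \<in> iso2 C (w \<odot> f1) (w \<odot> f2) \<longrightarrow> \<beta> \<in> iso2 C (f1 \<odot> v) (f2 \<odot> v))"
    and BF4c: "w \<in> W \<Longrightarrow> w \<in> hom C B A \<Longrightarrow> f1 \<in> hom C X B \<Longrightarrow> f2 \<in> hom C X B \<Longrightarrow>
      \<alpha> \<in> hom2 C (w \<odot> f1) (w \<odot> f2) \<Longrightarrow>
      BF4_triple C W w f1 f2 \<alpha> D v \<beta> \<Longrightarrow> BF4_triple C W w f1 f2 \<alpha> D' v' \<beta>' \<Longrightarrow>
      \<exists>E u u' \<zeta>. u \<in> hom C E D \<and> u' \<in> hom C E D' \<and> \<zeta> \<in> iso2 C (v \<odot> u) (v' \<odot> u') \<and>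
        v \<odot> u \<in> W \<and>
        rwhisker_assoc C f1 v' f2 v' \<beta>' u' \<bullet> (f1 \<triangleright> \<zeta>) =
        (f2 \<triangleright> \<zeta>) \<bullet> rwhisker_assoc C f1 v f2 v \<beta> u"
    and BF5: "w \<in> W \<Longrightarrow> \<alpha> \<in> iso2 C v w \<Longrightarrow> v \<in> W"

definition choices ::
  "('o, 'm, 'c) bicat \<Rightarrow> 'm set \<Rightarrow> ('m \<Rightarrow> 'm \<Rightarrow> 'o \<times> 'm \<times> 'm \<times> 'c) \<Rightarrow> bool" where
  "choices C W CW \<longleftrightarrow>
    (\<forall>A' B B' f v. f \<in> hom C A' B \<longrightarrow> v \<in> W \<longrightarrow> v \<in> hom C B' B \<longrightarrow>
      (case CW f v of (A'', v', f', \<rho>) \<Rightarrow>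
        v' \<in> W \<and> v' \<in> hom C A'' A' \<and> f' \<in> hom C A'' B' \<and>
        \<rho> \<in> iso2 C (f \<odot>\<^bsub>C\<^esub> v') (v \<odot>\<^bsub>C\<^esub> f')))"

section \<open>Morphisms and 2-morphisms of the bicategory of fractions\<close>

text \<open>
  The choices enter only the compositions of the bicategory of fractions, not its objects, its
  morphisms \<open>frac_hom\<close> or its 2-morphisms \<open>frac_hom2\<close>.
\<close>

definition frac_hom :: "('o, 'm, 'c) bicat \<Rightarrow> 'm set \<Rightarrow> 'o \<Rightarrow> 'o \<Rightarrow> ('o \<times> 'm \<times> 'm) set" where
  "frac_hom C W A B = {(A', w, f). w \<in> W \<and> w \<in> hom C A' A \<and> f \<in> hom C A' B}"

fun frac_data :: "('o, 'm, 'c) bicat \<Rightarrow> 'm set \<Rightarrow> 'o \<times> 'm \<times> 'm \<Rightarrow> 'o \<times> 'm \<times> 'm \<Rightarrow>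
    ('o \<times> 'm \<times> 'm \<times> 'c \<times> 'c) set" where
  "frac_data C W (A1, w1, f1) (A2, w2, f2) =
    {(A3, v1, v2, \<alpha>, \<beta>).
      v1 \<in> hom C A3 A1 \<and> v2 \<in> hom C A3 A2 \<and> w1 \<odot>\<^bsub>C\<^esub> v1 \<in> W \<and>
      \<alpha> \<in> iso2 C (w1 \<odot>\<^bsub>C\<^esub> v1) (w2 \<odot>\<^bsub>C\<^esub> v2) \<and> \<beta> \<in> hom2 C (f1 \<odot>\<^bsub>C\<^esub> v1) (f2 \<odot>\<^bsub>C\<^esub> v2)}"

fun frac_equiv :: "('o, 'm, 'c) bicat \<Rightarrow> 'm set \<Rightarrow> 'o \<times> 'm \<times> 'm \<Rightarrow> 'o \<times> 'm \<times> 'm \<Rightarrow>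
    (('o \<times> 'm \<times> 'm \<times> 'c \<times> 'c) \<times> ('o \<times> 'm \<times> 'm \<times> 'c \<times> 'c)) set" where
  "frac_equiv C W (A1, w1, f1) (A2, w2, f2) =
    {((A3, v1, v2, \<alpha>, \<beta>), (A3', v1', v2', \<alpha>', \<beta>')).
      (A3, v1, v2, \<alpha>, \<beta>) \<in> frac_data C W (A1, w1, f1) (A2, w2, f2) \<and>
      (A3', v1', v2', \<alpha>', \<beta>') \<in> frac_data C W (A1, w1, f1) (A2, w2, f2) \<and>
      (\<exists>A4 z z' \<sigma>1 \<sigma>2. z \<in> hom C A4 A3 \<and> z' \<in> hom C A4 A3' \<and>
        \<sigma>1 \<in> iso2 C (v1' \<odot>\<^bsub>C\<^esub> z') (v1 \<odot>\<^bsub>C\<^esub> z) \<and> \<sigma>2 \<in> iso2 C (v2 \<odot>\<^bsub>C\<^esub> z) (v2' \<odot>\<^bsub>C\<^esub> z') \<and>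
        (w1 \<odot>\<^bsub>C\<^esub> v1) \<odot>\<^bsub>C\<^esub> z \<in> W \<and>
        (w2 \<triangleright>\<^bsub>C\<^esub> \<sigma>2) \<bullet>\<^bsub>C\<^esub> rwhisker_assoc C w1 v1 w2 v2 \<alpha> z \<bullet>\<^bsub>C\<^esub> (w1 \<triangleright>\<^bsub>C\<^esub> \<sigma>1) =
          rwhisker_assoc C w1 v1' w2 v2' \<alpha>' z' \<and>
        (f2 \<triangleright>\<^bsub>C\<^esub> \<sigma>2) \<bullet>\<^bsub>C\<^esub> rwhisker_assoc C f1 v1 f2 v2 \<beta> z \<bullet>\<^bsub>C\<^esub> (f1 \<triangleright>\<^bsub>C\<^esub> \<sigma>1) =
          rwhisker_assoc C f1 v1' f2 v2' \<beta>' z')}"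

definition frac_hom2 :: "('o, 'm, 'c) bicat \<Rightarrow> 'm set \<Rightarrow> 'o \<times> 'm \<times> 'm \<Rightarrow> 'o \<times> 'm \<times> 'm \<Rightarrow>
    ('o \<times> 'm \<times> 'm \<times> 'c \<times> 'c) set set" where
  "frac_hom2 C W F1 F2 = frac_data C W F1 F2 // frac_equiv C W F1 F2"

section \<open>Almost canonical representatives\<close>

text \<open>
  Here \<open>(E, p, q, \<tau>)\<close> with \<open>\<tau> : w1 \<odot> p \<Rightarrow> w2 \<odot> q\<close> is the choice for
  \<open>(w1, w2)\<close>; \<open>f1 \<circ> p \<circ> t\<close> is read as \<open>f1 \<odot> (p \<odot> t)\<close>.
\<close>

fun acr_data :: "('o, 'm, 'c) bicat \<Rightarrow> 'm set \<Rightarrow> 'o \<times> 'm \<times> 'm \<times> 'c \<Rightarrow>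
    'o \<times> 'm \<times> 'm \<Rightarrow> 'o \<times> 'm \<times> 'm \<Rightarrow> ('o \<times> 'm \<times> 'c) set" where
  "acr_data C W (E, p, q, \<tau>) (A1, w1, f1) (A2, w2, f2) =
    {(A3, t, \<phi>). t \<in> W \<and> t \<in> hom C A3 E \<and>
      \<phi> \<in> hom2 C (f1 \<odot>\<^bsub>C\<^esub> (p \<odot>\<^bsub>C\<^esub> t)) (f2 \<odot>\<^bsub>C\<^esub> (q \<odot>\<^bsub>C\<^esub> t))}"

fun acr_equiv :: "('o, 'm, 'c) bicat \<Rightarrow> 'm set \<Rightarrow> 'o \<times> 'm \<times> 'm \<times> 'c \<Rightarrow>
    'o \<times> 'm \<times> 'm \<Rightarrow> 'o \<times> 'm \<times> 'm \<Rightarrow> (('o \<times> 'm \<times> 'c) \<times> ('o \<times> 'm \<times> 'c)) set" where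
  "acr_equiv C W (E, p, q, \<tau>) (A1, w1, f1) (A2, w2, f2) =
    {((A3, t, \<phi>), (A3', t', \<phi>')).
      (A3, t, \<phi>) \<in> acr_data C W (E, p, q, \<tau>) (A1, w1, f1) (A2, w2, f2) \<and>
      (A3', t', \<phi>') \<in> acr_data C W (E, p, q, \<tau>) (A1, w1, f1) (A2, w2, f2) \<and>
      (\<exists>A4 u u' \<sigma>. u \<in> W \<and> u \<in> hom C A4 A3 \<and> u' \<in> hom C A4 A3' \<and>
        \<sigma> \<in> iso2 C (t' \<odot>\<^bsub>C\<^esub> u') (t \<odot>\<^bsub>C\<^esub> u) \<and>
        (f2 \<triangleright>\<^bsub>C\<^esub> lwhisker_assoc C q t u t' u' (inv2 C \<sigma>)) \<bullet>\<^bsub>C\<^esub>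
          rwhisker_assoc C f1 (p \<odot>\<^bsub>C\<^esub> t) f2 (q \<odot>\<^bsub>C\<^esub> t) \<phi> u \<bullet>\<^bsub>C\<^esub>
          (f1 \<triangleright>\<^bsub>C\<^esub> lwhisker_assoc C p t' u' t u \<sigma>) =
        rwhisker_assoc C f1 (p \<odot>\<^bsub>C\<^esub> t') f2 (q \<odot>\<^bsub>C\<^esub> t') \<phi>' u')}"

end

theory Submission
  imports Defs
begin

text \<open>
  Restriction along a 1-morphism \<open>z\<close> makes the data \<open>(v1, v2, \<alpha>, \<beta>)\<close> over an object into a
  pseudofunctor, and Pronk's relation says that two data become isomorphic after restriction along
  suitable \<open>z\<close>, \<open>z'\<close>. Only three coherence facts are needed: restriction preserves isomorphisms,
  it is compatible with composition of 1-morphisms (pentagon), and 2-cells \<open>z' \<Rightarrow> z\<close> induce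
  isomorphisms. Almost canonical representatives \<open>(k, \<phi>)\<close> form a second such pseudofunctor and
  \<open>fcan (k, \<phi>) = (p \<odot> k, q \<odot> k, \<tau> \<triangleleft> k, \<phi>)\<close> commutes with restriction. It reflects isomorphy up to
  restriction along \<open>W\<close>, and each datum is, after restriction, in its image, because 1-morphisms
  and 2-cells lift through \<open>w1\<close>, \<open>w2\<close> and \<open>p\<close> up to \<open>W\<close>. There is no two-out-of-three property;
  instead, if \<open>w\<close> and \<open>w \<odot> z\<close> are in \<open>W\<close>, then some \<open>z \<odot> s\<close> is in \<open>W\<close>.
\<close>

section \<open>Calculus of 2-cells in a bicategory\<close>

text \<open>The two relations differ in two ways, and both differences shape the proof. Pronk's
  relation asks for \<open>w1 \<odot> v1 \<odot> z\<close> in \<open>W\<close>, the relation on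
  almost canonical representatives asks for \<open>u\<close> itself in \<open>W\<close>; so every
  Pronk equivalence is first improved, by further restriction, to one with \<open>z\<close> in
  \<open>W\<close>. Moreover Pronk's relation compares the two legs by independent 2-cells, while
  almost canonical representatives admit a single 2-cell, between the morphisms into
  \<open>E\<close>; conditions (BF4) have to manufacture it. Well-definedness and injectivity come
  out of one statement: the relation on almost canonical representatives is the preimage of Pronk's
  relation under \<open>fcan\<close>. It thereby inherits being an equivalence relation. The
  coherence facts stay so few because identities used as witnesses are never cancelled: they are
  kept in the composites on both sides. (BF5) is what moves membership in \<open>W\<close> across
  associators and the other comparison cells.\<close>

context bicategory
begin

lemma hom_iff: "f \<in> hom C X Y \<longleftrightarrow> f \<in> mor C \<and> src C f = X \<and> trg C f = Y"
  by (simp add: hom_def)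

lemma hom2_iff: "\<alpha> \<in> hom2 C f g \<longleftrightarrow> \<alpha> \<in> cell C \<and> dom2 C \<alpha> = f \<and> cod2 C \<alpha> = g"
  by (simp add: hom2_def)

text \<open>The endpoints are left to separate equations on \<open>dom2\<close> and
  \<open>cod2\<close>, so that invertibility of a composite can be proved by simplification along
  its structure.\<close>

definition invertible2 :: "'c \<Rightarrow> bool" where
  "invertible2 \<alpha> \<longleftrightarrow> (\<exists>\<beta>. inverse2 C \<alpha> \<beta>)"

lemma iso2_iff:
  "\<alpha> \<in> iso2 C f g \<longleftrightarrow> \<alpha> \<in> cell C \<and> dom2 C \<alpha> = f \<and> cod2 C \<alpha> = g \<and> invertible2 \<alpha>"
  by (auto simp: iso2_def hom2_def invertible2_def)

text \<open>Typing through \<open>mor\<close>, \<open>src\<close> and \<open>trg\<close> instead of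
  hom-sets lets the simplifier discharge side conditions by rewriting, without guessing intermediate
  objects.\<close>

lemma comp1_typing [simp]:
  assumes "f \<in> mor C" "g \<in> mor C" "src C g = trg C f"
  shows "g \<odot> f \<in> mor C" "src C (g \<odot> f) = src C f" "trg C (g \<odot> f) = trg C g"
  using comp1_hom[of f "src C f" "trg C f" g "trg C g"] assms by (auto simp: hom_iff)

lemma id1_typing [simp]:
  assumes "X \<in> obj C"
  shows "id1 C X \<in> mor C" "src C (id1 C X) = X" "trg C (id1 C X) = X"
  using id1_hom[OF assms] by (auto simp: hom_iff)

lemma id2_typing [simp]:
  assumes "f \<in> mor C"
  shows "id2 C f \<in> cell C" "dom2 C (id2 C f) = f" "cod2 C (id2 C f) = f"
  using id2_hom2[OF assms] by (auto simp: hom2_iff)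

lemma vcomp_typing [simp]:
  assumes "\<alpha> \<in> cell C" "\<beta> \<in> cell C" "dom2 C \<beta> = cod2 C \<alpha>"
  shows "\<beta> \<bullet> \<alpha> \<in> cell C" "dom2 C (\<beta> \<bullet> \<alpha>) = dom2 C \<alpha>" "cod2 C (\<beta> \<bullet> \<alpha>) = cod2 C \<beta>"
  using vcomp_hom2[of \<alpha> "dom2 C \<alpha>" "cod2 C \<alpha>" \<beta> "cod2 C \<beta>"] assms by (auto simp: hom2_iff)

lemma vcomp_id [simp]:
  assumes "\<alpha> \<in> cell C"
  shows "cod2 C \<alpha> = g \<Longrightarrow> id2 C g \<bullet> \<alpha> = \<alpha>" "dom2 C \<alpha> = f \<Longrightarrow> \<alpha> \<bullet> id2 C f = \<alpha>"
  using vcomp_id_left[of \<alpha> "dom2 C \<alpha>" g] vcomp_id_right[of \<alpha> f "cod2 C \<alpha>"] assms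
  by (auto simp: hom2_iff)

text \<open>Fixes the normal form of vertical composites as bracketed to the right. The infix itself
  associates to the left, hence the explicit parentheses in later statements.\<close>

lemma vcomp_assoc_right [simp]:
  assumes "\<alpha> \<in> cell C" "\<beta> \<in> cell C" "\<gamma> \<in> cell C" "dom2 C \<beta> = cod2 C \<alpha>" "dom2 C \<gamma> = cod2 C \<beta>"
  shows "\<gamma> \<bullet> \<beta> \<bullet> \<alpha> = \<gamma> \<bullet> (\<beta> \<bullet> \<alpha>)"
  using vcomp_assoc[of \<alpha> "dom2 C \<alpha>" "cod2 C \<alpha>" \<beta> "cod2 C \<beta>" \<gamma> "cod2 C \<gamma>"] assms
  by (auto simp: hom2_iff)

lemma lwhisker_typing [simp]:
  assumes "g \<in> mor C" "\<alpha> \<in> cell C" "src C g = trg C (dom2 C \<alpha>)"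
  shows "g \<triangleright> \<alpha> \<in> cell C" "dom2 C (g \<triangleright> \<alpha>) = g \<odot> dom2 C \<alpha>" "cod2 C (g \<triangleright> \<alpha>) = g \<odot> cod2 C \<alpha>"
  using hcomp_hom2[of \<alpha> "dom2 C \<alpha>" "cod2 C \<alpha>" "id2 C g" g g] assms
  by (auto simp: hom2_iff lwhisker_def)

lemma rwhisker_typing [simp]:
  assumes "f \<in> mor C" "\<alpha> \<in> cell C" "src C (dom2 C \<alpha>) = trg C f"
  shows "\<alpha> \<triangleleft> f \<in> cell C" "dom2 C (\<alpha> \<triangleleft> f) = dom2 C \<alpha> \<odot> f" "cod2 C (\<alpha> \<triangleleft> f) = cod2 C \<alpha> \<odot> f"
  using hcomp_hom2[of "id2 C f" f f \<alpha> "dom2 C \<alpha>" "cod2 C \<alpha>"] assms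
  by (auto simp: hom2_iff rwhisker_def)

lemma lwhisker_id [simp]:
  "f \<in> mor C \<Longrightarrow> g \<in> mor C \<Longrightarrow> src C g = trg C f \<Longrightarrow> g \<triangleright> id2 C f = id2 C (g \<odot> f)"
  by (simp add: lwhisker_def hcomp_id[of f "src C f" "trg C f" g "trg C g"] hom_iff)

lemma rwhisker_id [simp]:
  "f \<in> mor C \<Longrightarrow> g \<in> mor C \<Longrightarrow> src C g = trg C f \<Longrightarrow> id2 C g \<triangleleft> f = id2 C (g \<odot> f)"
  by (simp add: rwhisker_def hcomp_id[of f "src C f" "trg C f" g "trg C g"] hom_iff)

lemma lwhisker_vcomp:
  assumes "g \<in> mor C" "\<alpha> \<in> cell C" "\<beta> \<in> cell C" "dom2 C \<beta> = cod2 C \<alpha>" "src C g = trg C (dom2 C \<alpha>)"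
  shows "g \<triangleright> (\<beta> \<bullet> \<alpha>) = (g \<triangleright> \<beta>) \<bullet> (g \<triangleright> \<alpha>)"
  using interchange[of \<alpha> "dom2 C \<alpha>" "cod2 C \<alpha>" \<beta> "cod2 C \<beta>" "id2 C g" g g "id2 C g" g] assms
  by (simp add: hom2_iff lwhisker_def)

lemma rwhisker_vcomp:
  assumes "f \<in> mor C" "\<alpha> \<in> cell C" "\<beta> \<in> cell C" "dom2 C \<beta> = cod2 C \<alpha>" "src C (dom2 C \<alpha>) = trg C f"
  shows "(\<beta> \<bullet> \<alpha>) \<triangleleft> f = (\<beta> \<triangleleft> f) \<bullet> (\<alpha> \<triangleleft> f)"
  using interchange[of "id2 C f" f f "id2 C f" f \<alpha> "dom2 C \<alpha>" "cod2 C \<alpha>" \<beta> "cod2 C \<beta>"] assms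
  by (simp add: hom2_iff rwhisker_def)

text \<open>Both sides are the horizontal composite of \<open>\<beta>\<close> and
  \<open>\<alpha>\<close>, split by interchange in the two possible orders.\<close>

lemma whisker_exchange:
  assumes "\<alpha> \<in> cell C" "\<beta> \<in> cell C" "src C (dom2 C \<beta>) = trg C (dom2 C \<alpha>)"
  shows "(\<beta> \<triangleleft> cod2 C \<alpha>) \<bullet> (dom2 C \<beta> \<triangleright> \<alpha>) = (cod2 C \<beta> \<triangleright> \<alpha>) \<bullet> (\<beta> \<triangleleft> dom2 C \<alpha>)"
  using interchange[of \<alpha> "dom2 C \<alpha>" "cod2 C \<alpha>" "id2 C (cod2 C \<alpha>)" "cod2 C \<alpha>"
      "id2 C (dom2 C \<beta>)" "dom2 C \<beta>" "dom2 C \<beta>" \<beta> "cod2 C \<beta>"]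
    interchange[of "id2 C (dom2 C \<alpha>)" "dom2 C \<alpha>" "dom2 C \<alpha>" \<alpha> "cod2 C \<alpha>"
      \<beta> "dom2 C \<beta>" "cod2 C \<beta>" "id2 C (cod2 C \<beta>)" "cod2 C \<beta>"] assms
  by (simp add: hom2_iff lwhisker_def rwhisker_def dom2_mor cod2_mor)

section \<open>Inverse 2-cells\<close>

lemma inverse2_unique:
  assumes "inverse2 C \<alpha> \<beta>" "inverse2 C \<alpha> \<gamma>" shows "\<beta> = \<gamma>"
proof -
  have *: "\<alpha> \<in> cell C" "\<beta> \<in> cell C" "\<gamma> \<in> cell C" "dom2 C \<beta> = cod2 C \<alpha>" "cod2 C \<beta> = dom2 C \<alpha>"
    "dom2 C \<gamma> = cod2 C \<alpha>" "cod2 C \<gamma> = dom2 C \<alpha>" "\<beta> \<bullet> \<alpha> = id2 C (dom2 C \<alpha>)" "\<alpha> \<bullet> \<gamma> = id2 C (cod2 C \<alpha>)"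
    using assms by (auto simp: inverse2_def hom2_iff)
  have "\<beta> = \<beta> \<bullet> (\<alpha> \<bullet> \<gamma>)" using * by simp
  also have "\<dots> = \<beta> \<bullet> \<alpha> \<bullet> \<gamma>" using * by (subst vcomp_assoc_right) auto
  also have "\<dots> = \<gamma>" using * by simp
  finally show ?thesis .
qed

lemma inv2_eqI: "inverse2 C \<alpha> \<beta> \<Longrightarrow> inv2 C \<alpha> = \<beta>"
  unfolding inv2_def using inverse2_unique by blast

lemma inverse2_inv2: "invertible2 \<alpha> \<Longrightarrow> inverse2 C \<alpha> (inv2 C \<alpha>)"
  using inv2_eqI by (auto simp: invertible2_def)

lemma invertible2_cell: "invertible2 \<alpha> \<Longrightarrow> \<alpha> \<in> cell C"
  by (auto simp: invertible2_def inverse2_def)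

lemma inv2_typing [simp]:
  assumes "invertible2 \<alpha>"
  shows "inv2 C \<alpha> \<in> cell C" "dom2 C (inv2 C \<alpha>) = cod2 C \<alpha>" "cod2 C (inv2 C \<alpha>) = dom2 C \<alpha>"
  using inverse2_inv2[OF assms] by (auto simp: inverse2_def hom2_iff)

lemma inv2_inverse [simp]:
  assumes "invertible2 \<alpha>"
  shows "inv2 C \<alpha> \<bullet> \<alpha> = id2 C (dom2 C \<alpha>)" "\<alpha> \<bullet> inv2 C \<alpha> = id2 C (cod2 C \<alpha>)"
  using inverse2_inv2[OF assms] by (auto simp: inverse2_def)

text \<open>In the right-bracketed normal form a cell and its inverse are adjacent only up to a
  trailing composite, so cancellation has to be available with that composite attached.\<close>

lemma inv2_cancel [simp]:
  assumes "invertible2 \<alpha>" "\<beta> \<in> cell C"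
  shows "cod2 C \<beta> = dom2 C \<alpha> \<Longrightarrow> inv2 C \<alpha> \<bullet> (\<alpha> \<bullet> \<beta>) = \<beta>"
    "cod2 C \<beta> = cod2 C \<alpha> \<Longrightarrow> \<alpha> \<bullet> (inv2 C \<alpha> \<bullet> \<beta>) = \<beta>"
proof -
  note [simp] = invertible2_cell[OF assms(1)] assms(2)
  show "inv2 C \<alpha> \<bullet> (\<alpha> \<bullet> \<beta>) = \<beta>" if "cod2 C \<beta> = dom2 C \<alpha>"
    using that assms by (subst vcomp_assoc_right[symmetric]) auto
  show "\<alpha> \<bullet> (inv2 C \<alpha> \<bullet> \<beta>) = \<beta>" if "cod2 C \<beta> = cod2 C \<alpha>"
    using that assms by (subst vcomp_assoc_right[symmetric]) auto
qed

lemma inverse2I: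
  assumes "\<alpha> \<in> cell C" "\<beta> \<in> cell C" "dom2 C \<beta> = cod2 C \<alpha>" "cod2 C \<beta> = dom2 C \<alpha>"
    "\<beta> \<bullet> \<alpha> = id2 C (dom2 C \<alpha>)" "\<alpha> \<bullet> \<beta> = id2 C (cod2 C \<alpha>)"
  shows "inverse2 C \<alpha> \<beta>"
  using assms by (simp add: inverse2_def hom2_iff)

lemma invertible2I: "inverse2 C \<alpha> \<beta> \<Longrightarrow> invertible2 \<alpha>"
  by (auto simp: invertible2_def)

lemma inverse2_id2: "f \<in> mor C \<Longrightarrow> inverse2 C (id2 C f) (id2 C f)"
  by (rule inverse2I) auto

lemma inverse2_inv2_flip: "invertible2 \<alpha> \<Longrightarrow> inverse2 C (inv2 C \<alpha>) \<alpha>"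
  by (rule inverse2I) (auto simp: invertible2_cell)

lemma inverse2_vcomp:
  assumes "invertible2 \<alpha>" "invertible2 \<beta>" "dom2 C \<beta> = cod2 C \<alpha>"
  shows "inverse2 C (\<beta> \<bullet> \<alpha>) (inv2 C \<alpha> \<bullet> inv2 C \<beta>)"
proof -
  note [simp] = invertible2_cell[OF assms(1)] invertible2_cell[OF assms(2)] assms
  have "inv2 C \<beta> \<bullet> (\<beta> \<bullet> \<alpha>) = \<alpha>" by (rule inv2_cancel) simp_all
  moreover have "\<alpha> \<bullet> (inv2 C \<alpha> \<bullet> inv2 C \<beta>) = inv2 C \<beta>" by (rule inv2_cancel) simp_all
  ultimately show ?thesis by (intro inverse2I) auto
qed

lemma inverse2_lwhisker:
  assumes "invertible2 \<alpha>" "g \<in> mor C" "src C g = trg C (dom2 C \<alpha>)"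
  shows "inverse2 C (g \<triangleright> \<alpha>) (g \<triangleright> inv2 C \<alpha>)"
proof -
  note [simp] = invertible2_cell[OF assms(1)]
  have "trg C (cod2 C \<alpha>) = trg C (dom2 C \<alpha>)" by (simp add: trg_parallel)
  then show ?thesis using assms
    by (intro inverse2I) (auto simp: lwhisker_vcomp[symmetric] dom2_mor cod2_mor)
qed

lemma inverse2_rwhisker:
  assumes "invertible2 \<alpha>" "f \<in> mor C" "src C (dom2 C \<alpha>) = trg C f"
  shows "inverse2 C (\<alpha> \<triangleleft> f) (inv2 C \<alpha> \<triangleleft> f)"
proof -
  note [simp] = invertible2_cell[OF assms(1)]
  have "src C (cod2 C \<alpha>) = src C (dom2 C \<alpha>)" by (simp add: src_parallel)
  then show ?thesis using assms
    by (intro inverse2I) (auto simp: rwhisker_vcomp[symmetric] dom2_mor cod2_mor)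
qed

lemma invertible2_intros [simp]:
  "f \<in> mor C \<Longrightarrow> invertible2 (id2 C f)"
  "invertible2 \<alpha> \<Longrightarrow> invertible2 (inv2 C \<alpha>)"
  "invertible2 \<alpha> \<Longrightarrow> invertible2 \<beta> \<Longrightarrow> dom2 C \<beta> = cod2 C \<alpha> \<Longrightarrow> invertible2 (\<beta> \<bullet> \<alpha>)"
  "invertible2 \<alpha> \<Longrightarrow> g \<in> mor C \<Longrightarrow> src C g = trg C (dom2 C \<alpha>) \<Longrightarrow> invertible2 (g \<triangleright> \<alpha>)"
  "invertible2 \<alpha> \<Longrightarrow> f \<in> mor C \<Longrightarrow> src C (dom2 C \<alpha>) = trg C f \<Longrightarrow> invertible2 (\<alpha> \<triangleleft> f)"
  by (blast intro: invertible2I inverse2_id2 inverse2_inv2_flip inverse2_vcomp inverse2_lwhisker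
      inverse2_rwhisker)+

lemma inv2_simps [simp]:
  "f \<in> mor C \<Longrightarrow> inv2 C (id2 C f) = id2 C f"
  "invertible2 \<alpha> \<Longrightarrow> inv2 C (inv2 C \<alpha>) = \<alpha>"
  "invertible2 \<alpha> \<Longrightarrow> invertible2 \<beta> \<Longrightarrow> dom2 C \<beta> = cod2 C \<alpha> \<Longrightarrow>
    inv2 C (\<beta> \<bullet> \<alpha>) = inv2 C \<alpha> \<bullet> inv2 C \<beta>"
  "invertible2 \<alpha> \<Longrightarrow> g \<in> mor C \<Longrightarrow> src C g = trg C (dom2 C \<alpha>) \<Longrightarrow>
    inv2 C (g \<triangleright> \<alpha>) = g \<triangleright> inv2 C \<alpha>"
  "invertible2 \<alpha> \<Longrightarrow> f \<in> mor C \<Longrightarrow> src C (dom2 C \<alpha>) = trg C f \<Longrightarrow>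
    inv2 C (\<alpha> \<triangleleft> f) = inv2 C \<alpha> \<triangleleft> f"
  by (blast intro: inv2_eqI inverse2_id2 inverse2_inv2_flip inverse2_vcomp inverse2_lwhisker
      inverse2_rwhisker)+

section \<open>Associators: naturality in each variable and the pentagon\<close>

lemma assoc_typing [simp]:
  assumes "f \<in> mor C" "g \<in> mor C" "h \<in> mor C" "src C g = trg C f" "src C h = trg C g"
  shows "assoc C h g f \<in> cell C" "dom2 C (assoc C h g f) = h \<odot> g \<odot> f"
    "cod2 C (assoc C h g f) = h \<odot> (g \<odot> f)" "invertible2 (assoc C h g f)"
  using assoc_iso2[of f "src C f" "trg C f" g "trg C g" h "trg C h"] assms
  by (auto simp: iso2_iff hom_iff)

lemma assoc_natural_left:
  assumes "\<alpha> \<in> cell C" "dom2 C \<alpha> = f" "cod2 C \<alpha> = f'" "g \<in> mor C" "h \<in> mor C" "src C g = trg C f" "src C h = trg C g"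
  shows "assoc C h g f' \<bullet> (h \<odot> g \<triangleright> \<alpha>) = (h \<triangleright> g \<triangleright> \<alpha>) \<bullet> assoc C h g f"
  using assoc_natural[of \<alpha> f f' "id2 C g" g g "id2 C h" h h] assms
    hcomp_id[of g "src C g" "trg C g" h "trg C h"]
  by (simp add: hom2_iff hom_iff lwhisker_def)

lemma assoc_natural_middle:
  assumes "\<beta> \<in> cell C" "dom2 C \<beta> = g" "cod2 C \<beta> = g'" "f \<in> mor C" "h \<in> mor C" "src C g = trg C f" "src C h = trg C g"
  shows "assoc C h g' f \<bullet> ((h \<triangleright> \<beta>) \<triangleleft> f) = (h \<triangleright> (\<beta> \<triangleleft> f)) \<bullet> assoc C h g f"
  using assoc_natural[of "id2 C f" f f \<beta> g g' "id2 C h" h h] assms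
  by (simp add: hom2_iff hom_iff lwhisker_def rwhisker_def)

lemma assoc_natural_right:
  assumes "\<gamma> \<in> cell C" "dom2 C \<gamma> = h" "cod2 C \<gamma> = h'" "f \<in> mor C" "g \<in> mor C" "src C g = trg C f" "src C h = trg C g"
  shows "assoc C h' g f \<bullet> (\<gamma> \<triangleleft> g \<triangleleft> f) = (\<gamma> \<triangleleft> (g \<odot> f)) \<bullet> assoc C h g f"
  using assoc_natural[of "id2 C f" f f "id2 C g" g g \<gamma> h h'] assms
    hcomp_id[of f "src C f" "trg C f" g "trg C g"]
  by (simp add: hom2_iff hom_iff rwhisker_def)


text \<open>Turns an equation about a composite of two cells into a rewrite rule inside a
  right-bracketed composite; applied in the form \<open>[THEN vcomp_reassoc]\<close>.\<close>

lemma vcomp_reassoc: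
  assumes "\<beta> \<bullet> \<alpha> = \<delta>" "\<alpha> \<in> cell C" "\<beta> \<in> cell C" "\<gamma> \<in> cell C" "dom2 C \<beta> = cod2 C \<alpha>" "dom2 C \<alpha> = cod2 C \<gamma>"
  shows "\<beta> \<bullet> (\<alpha> \<bullet> \<gamma>) = \<delta> \<bullet> \<gamma>"
  using assms vcomp_assoc_right[of \<gamma> \<alpha> \<beta>] by simp

lemma inv2_cancel_left:
  assumes "\<alpha> \<bullet> \<beta> = \<alpha> \<bullet> \<gamma>" "invertible2 \<alpha>" "\<beta> \<in> cell C" "\<gamma> \<in> cell C"
    "cod2 C \<beta> = dom2 C \<alpha>" "cod2 C \<gamma> = dom2 C \<alpha>"
  shows "\<beta> = \<gamma>"
  by (metis assms inv2_cancel(1))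

lemma inv2_cancel_right:
  assumes "\<beta> \<bullet> \<alpha> = \<gamma> \<bullet> \<alpha>" "invertible2 \<alpha>" "\<beta> \<in> cell C" "\<gamma> \<in> cell C"
    "dom2 C \<beta> = cod2 C \<alpha>" "dom2 C \<gamma> = cod2 C \<alpha>"
  shows "\<beta> = \<gamma>"
proof -
  have "\<beta> \<bullet> \<alpha> \<bullet> inv2 C \<alpha> = \<gamma> \<bullet> \<alpha> \<bullet> inv2 C \<alpha>" by (simp add: assms(1))
  then show ?thesis using assms(2-) by (simp add: invertible2_cell)
qed

lemma pentagon_right:
  assumes "f \<in> mor C" "g \<in> mor C" "h \<in> mor C" "k \<in> mor C"
    "src C g = trg C f" "src C h = trg C g" "src C k = trg C h"
  shows "(k \<triangleright> assoc C h g f) \<bullet> (assoc C k (h \<odot> g) f \<bullet> (assoc C k h g \<triangleleft> f)) =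
    assoc C k h (g \<odot> f) \<bullet> assoc C (k \<odot> h) g f"
  using pentagon[of f "src C f" "trg C f" g "trg C g" h "trg C h" k "trg C k"] assms
  by (simp add: hom_iff)

text \<open>\<open>rwhisker_assoc\<close> has an associator at its left end and an inverse one at
  its right end, so iterating it calls for the pentagon in both forms.\<close>

lemma pentagon_inverse:
  assumes "f \<in> mor C" "g \<in> mor C" "h \<in> mor C" "k \<in> mor C"
    "src C g = trg C f" "src C h = trg C g" "src C k = trg C h"
  shows "(inv2 C (assoc C k h g) \<triangleleft> f) \<bullet> (inv2 C (assoc C k (h \<odot> g) f) \<bullet> (k \<triangleright> inv2 C (assoc C h g f))) =
    inv2 C (assoc C (k \<odot> h) g f) \<bullet> inv2 C (assoc C k h (g \<odot> f))"
  using arg_cong[OF pentagon_right[OF assms], of "inv2 C"] assms by simp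

lemma rwhisker_comp1:
  assumes "\<delta> \<in> cell C" "dom2 C \<delta> = f" "cod2 C \<delta> = g" "z \<in> mor C" "u \<in> mor C"
    "src C f = trg C z" "src C g = trg C z" "src C z = trg C u"
  shows "\<delta> \<triangleleft> (z \<odot> u) = assoc C g z u \<bullet> ((\<delta> \<triangleleft> z \<triangleleft> u) \<bullet> inv2 C (assoc C f z u))"
proof -
  have fg: "f \<in> mor C" "g \<in> mor C" using assms dom2_mor cod2_mor by blast+
  note [simp] = assms fg
  have "assoc C g z u \<bullet> (\<delta> \<triangleleft> z \<triangleleft> u) \<bullet> inv2 C (assoc C f z u) =
      (\<delta> \<triangleleft> (z \<odot> u)) \<bullet> assoc C f z u \<bullet> inv2 C (assoc C f z u)"
    using assoc_natural_right[of \<delta> f g u z] by simp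
  then show ?thesis by simp
qed

section \<open>Restriction of a 2-cell between composites along a 1-morphism\<close>

context
  fixes g1 v1 g2 v2 \<delta> u
  assumes mor: "g1 \<in> mor C" "v1 \<in> mor C" "g2 \<in> mor C" "v2 \<in> mor C" "u \<in> mor C"
    and comp: "src C g1 = trg C v1" "src C g2 = trg C v2" "src C v1 = trg C u" "src C v2 = trg C u"
    and \<delta>: "\<delta> \<in> cell C" "dom2 C \<delta> = g1 \<odot> v1" "cod2 C \<delta> = g2 \<odot> v2"
begin

lemma rwhisker_assoc_typing [simp]:
  "rwhisker_assoc C g1 v1 g2 v2 \<delta> u \<in> cell C"
  "dom2 C (rwhisker_assoc C g1 v1 g2 v2 \<delta> u) = g1 \<odot> (v1 \<odot> u)"
  "cod2 C (rwhisker_assoc C g1 v1 g2 v2 \<delta> u) = g2 \<odot> (v2 \<odot> u)"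
  using mor comp \<delta> by (auto simp: rwhisker_assoc_def)

lemma rwhisker_assoc_invertible [simp]:
  "invertible2 \<delta> \<Longrightarrow> invertible2 (rwhisker_assoc C g1 v1 g2 v2 \<delta> u)"
  using mor comp \<delta> by (auto simp: rwhisker_assoc_def)

lemma rwhisker_assoc_vcomp:
  assumes "g3 \<in> mor C" "v3 \<in> mor C" "src C g3 = trg C v3" "src C v3 = trg C u"
    "\<gamma> \<in> cell C" "dom2 C \<gamma> = g2 \<odot> v2" "cod2 C \<gamma> = g3 \<odot> v3"
  shows "rwhisker_assoc C g1 v1 g3 v3 (\<gamma> \<bullet> \<delta>) u =
    rwhisker_assoc C g2 v2 g3 v3 \<gamma> u \<bullet> rwhisker_assoc C g1 v1 g2 v2 \<delta> u"
  using mor comp \<delta> assms by (simp add: rwhisker_assoc_def rwhisker_vcomp)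

text \<open>Restricting in two steps and in one step differ by associators of the legs only. This is
  one pentagon at each end of \<open>\<delta>\<close>, with naturality of the associator in
  between.\<close>

lemma rwhisker_assoc_comp1:
  assumes "z \<in> mor C" "src C u = trg C z"
  shows "(g2 \<triangleright> assoc C v2 u z) \<bullet>
      (rwhisker_assoc C g1 (v1 \<odot> u) g2 (v2 \<odot> u) (rwhisker_assoc C g1 v1 g2 v2 \<delta> u) z \<bullet>
        (g1 \<triangleright> inv2 C (assoc C v1 u z))) =
    rwhisker_assoc C g1 v1 g2 v2 \<delta> (u \<odot> z)"
proof -
  note [simp] = mor comp \<delta> assms
  \<comment> \<open>The composite is regrouped to expose the pentagon for \<open>g2\<close>,
    \<open>v2\<close> on the left of \<open>\<delta>\<close> and the inverse pentagon for
    \<open>g1\<close>, \<open>v1\<close> on its right.\<close>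
  have eq: "?thesis \<longleftrightarrow>
    (g2 \<triangleright> assoc C v2 u z) \<bullet> (assoc C g2 (v2 \<odot> u) z \<bullet> (assoc C g2 v2 u \<triangleleft> z)) \<bullet> (\<delta> \<triangleleft> u \<triangleleft> z) \<bullet>
    ((inv2 C (assoc C g1 v1 u) \<triangleleft> z) \<bullet> (inv2 C (assoc C g1 (v1 \<odot> u) z) \<bullet> (g1 \<triangleright> inv2 C (assoc C v1 u z)))) =
    rwhisker_assoc C g1 v1 g2 v2 \<delta> (u \<odot> z)"
    by (simp add: rwhisker_assoc_def rwhisker_vcomp)
  show ?thesis
    unfolding eq by (subst pentagon_right, simp_all, subst pentagon_inverse)
      (simp_all add: rwhisker_assoc_def rwhisker_comp1[OF \<delta>])
qed

lemma rwhisker_assoc_2cell: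
  assumes "\<zeta> \<in> cell C" "dom2 C \<zeta> = u" "cod2 C \<zeta> = u'"
  shows "rwhisker_assoc C g1 v1 g2 v2 \<delta> u' \<bullet> (g1 \<triangleright> v1 \<triangleright> \<zeta>) =
    (g2 \<triangleright> v2 \<triangleright> \<zeta>) \<bullet> rwhisker_assoc C g1 v1 g2 v2 \<delta> u"
proof -
  have u': "u' \<in> mor C" "src C u' = src C u" "trg C u' = trg C u"
    using assms cod2_mor src_parallel[of \<zeta>] trg_parallel[of \<zeta>] by auto
  note [simp] = mor comp \<delta> assms u'
  \<comment> \<open>Naturality of the associator, solved for the inverse associator.\<close>
  have 1: "inv2 C (assoc C g1 v1 u') \<bullet> (g1 \<triangleright> v1 \<triangleright> \<zeta>) = (g1 \<odot> v1 \<triangleright> \<zeta>) \<bullet> inv2 C (assoc C g1 v1 u)"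
  proof (rule inv2_cancel_right[where \<alpha> = "assoc C g1 v1 u"])
    have "inv2 C (assoc C g1 v1 u') \<bullet> (assoc C g1 v1 u' \<bullet> (g1 \<odot> v1 \<triangleright> \<zeta>)) = (g1 \<odot> v1 \<triangleright> \<zeta>)"
      by simp
    then show "inv2 C (assoc C g1 v1 u') \<bullet> (g1 \<triangleright> v1 \<triangleright> \<zeta>) \<bullet> assoc C g1 v1 u =
        (g1 \<odot> v1 \<triangleright> \<zeta>) \<bullet> inv2 C (assoc C g1 v1 u) \<bullet> assoc C g1 v1 u"
      using assoc_natural_left[of \<zeta> u u' v1 g1] by simp
  qed simp_all
  have 2: "(\<delta> \<triangleleft> u') \<bullet> (g1 \<odot> v1 \<triangleright> \<zeta>) = (g2 \<odot> v2 \<triangleright> \<zeta>) \<bullet> (\<delta> \<triangleleft> u)"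
    using whisker_exchange[of \<zeta> \<delta>] by simp
  have 3: "assoc C g2 v2 u' \<bullet> (g2 \<odot> v2 \<triangleright> \<zeta>) = (g2 \<triangleright> v2 \<triangleright> \<zeta>) \<bullet> assoc C g2 v2 u"
    by (rule assoc_natural_left) simp_all
  from 1 show ?thesis
    by (simp add: rwhisker_assoc_def 2[THEN vcomp_reassoc] 3[THEN vcomp_reassoc])
qed

end

text \<open>Naturality of the associator in its middle variable makes the two associators cancel.
  This is how whiskered comparison cells pass through restriction.\<close>

lemma rwhisker_assoc_lwhisker:
  assumes "\<sigma> \<in> cell C" "dom2 C \<sigma> = f" "cod2 C \<sigma> = f'" "g \<in> mor C" "u \<in> mor C"
    "src C g = trg C f" "src C f = trg C u"
  shows "rwhisker_assoc C g f g f' (g \<triangleright> \<sigma>) u = g \<triangleright> (\<sigma> \<triangleleft> u)"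
proof -
  have f: "f \<in> mor C" "f' \<in> mor C" "src C f' = src C f" "trg C f' = trg C f"
    using assms dom2_mor cod2_mor src_parallel[of \<sigma>] trg_parallel[of \<sigma>] by auto
  note [simp] = assms f
  show ?thesis
    by (simp add: rwhisker_assoc_def assoc_natural_middle[THEN vcomp_reassoc, of \<sigma> f f' u g])
qed


section \<open>Data over an object\<close>

text \<open>Only one pair \<open>g1\<close>, \<open>g2\<close> occurs, so that each result applies
  twice: to \<open>w1\<close>, \<open>w2\<close> with the component \<open>\<alpha>\<close>, and to
  \<open>f1\<close>, \<open>f2\<close> with the component \<open>\<beta>\<close>.\<close>

definition datum :: "'m \<Rightarrow> 'm \<Rightarrow> 'o \<Rightarrow> 'm \<Rightarrow> 'm \<Rightarrow> 'c \<Rightarrow> bool" where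
  "datum g1 g2 X v1 v2 \<delta> \<longleftrightarrow> g1 \<in> mor C \<and> g2 \<in> mor C \<and> v1 \<in> mor C \<and> v2 \<in> mor C \<and>
    src C v1 = X \<and> src C v2 = X \<and> src C g1 = trg C v1 \<and> src C g2 = trg C v2 \<and>
    \<delta> \<in> cell C \<and> dom2 C \<delta> = g1 \<odot> v1 \<and> cod2 C \<delta> = g2 \<odot> v2"

text \<open>The comparison of first legs runs backwards and that of second legs forwards, as in
  Pronk's relation; composing then needs no inverses in the defining equation.\<close>

definition datum_iso ::
  "'m \<Rightarrow> 'm \<Rightarrow> 'o \<Rightarrow> 'm \<Rightarrow> 'm \<Rightarrow> 'c \<Rightarrow> 'm \<Rightarrow> 'm \<Rightarrow> 'c \<Rightarrow> 'c \<Rightarrow> 'c \<Rightarrow> bool" where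
  "datum_iso g1 g2 X v1 v2 \<delta> v1' v2' \<delta>' \<sigma>1 \<sigma>2 \<longleftrightarrow>
    datum g1 g2 X v1 v2 \<delta> \<and> datum g1 g2 X v1' v2' \<delta>' \<and>
    dom2 C \<sigma>1 = v1' \<and> cod2 C \<sigma>1 = v1 \<and> invertible2 \<sigma>1 \<and>
    dom2 C \<sigma>2 = v2 \<and> cod2 C \<sigma>2 = v2' \<and> invertible2 \<sigma>2 \<and>
    (g2 \<triangleright> \<sigma>2) \<bullet> (\<delta> \<bullet> (g1 \<triangleright> \<sigma>1)) = \<delta>'"

lemma datum_iso_iff:
  assumes "datum g1 g2 X v1 v2 \<delta>" "datum g1 g2 X v1' v2' \<delta>'"
  shows "datum_iso g1 g2 X v1 v2 \<delta> v1' v2' \<delta>' \<sigma>1 \<sigma>2 \<longleftrightarrow>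
    \<sigma>1 \<in> iso2 C v1' v1 \<and> \<sigma>2 \<in> iso2 C v2 v2' \<and> (g2 \<triangleright> \<sigma>2) \<bullet> \<delta> \<bullet> (g1 \<triangleright> \<sigma>1) = \<delta>'"
  using assms by (auto simp: datum_iso_def datum_def iso2_iff invertible2_cell)

text \<open>Invertible cells on the legs determine the 2-cell of the target, so a datum can be
  carried along them. This is how new 2-cells such as \<open>\<phi>\<close> are created.\<close>

lemma datum_iso_transport:
  assumes "datum g1 g2 X v1 v2 \<delta>" "dom2 C \<sigma>1 = v1'" "cod2 C \<sigma>1 = v1" "invertible2 \<sigma>1"
    "dom2 C \<sigma>2 = v2" "cod2 C \<sigma>2 = v2'" "invertible2 \<sigma>2"
  shows "datum_iso g1 g2 X v1 v2 \<delta> v1' v2' ((g2 \<triangleright> \<sigma>2) \<bullet> (\<delta> \<bullet> (g1 \<triangleright> \<sigma>1))) \<sigma>1 \<sigma>2"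
proof -
  have c: "\<sigma>1 \<in> cell C" "\<sigma>2 \<in> cell C" using assms by (auto simp: invertible2_cell)
  have "v1' \<in> mor C" "src C v1' = src C v1" "trg C v1' = trg C v1"
    "v2' \<in> mor C" "src C v2' = src C v2" "trg C v2' = trg C v2"
    using c assms dom2_mor cod2_mor src_parallel trg_parallel by metis+
  then show ?thesis using assms c by (auto simp: datum_iso_def datum_def)
qed

lemma datum_iso_refl:
  "datum g1 g2 X v1 v2 \<delta> \<Longrightarrow> datum_iso g1 g2 X v1 v2 \<delta> v1 v2 \<delta> (id2 C v1) (id2 C v2)"
  by (auto simp: datum_iso_def datum_def)

lemma datum_iso_sym:
  assumes "datum_iso g1 g2 X v1 v2 \<delta> v1' v2' \<delta>' \<sigma>1 \<sigma>2"
  shows "datum_iso g1 g2 X v1' v2' \<delta>' v1 v2 \<delta> (inv2 C \<sigma>1) (inv2 C \<sigma>2)"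
proof -
  have i: "invertible2 \<sigma>1" "invertible2 \<sigma>2" using assms by (auto simp: datum_iso_def)
  note [simp] = invertible2_cell[OF i(1)] invertible2_cell[OF i(2)]
  have "inv2 C (g2 \<triangleright> \<sigma>2) \<bullet> ((g2 \<triangleright> \<sigma>2) \<bullet> (\<delta> \<bullet> (g1 \<triangleright> \<sigma>1)) \<bullet> inv2 C (g1 \<triangleright> \<sigma>1)) = \<delta>"
    using assms by (auto simp: datum_iso_def datum_def simp del: inv2_simps)
  then show ?thesis using assms by (auto simp: datum_iso_def datum_def)
qed

lemma datum_iso_trans:
  assumes "datum_iso g1 g2 X v1 v2 \<delta> v1' v2' \<delta>' \<sigma>1 \<sigma>2"
    and "datum_iso g1 g2 X v1' v2' \<delta>' v1'' v2'' \<delta>'' \<sigma>1' \<sigma>2'"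
  shows "datum_iso g1 g2 X v1 v2 \<delta> v1'' v2'' \<delta>'' (\<sigma>1 \<bullet> \<sigma>1') (\<sigma>2' \<bullet> \<sigma>2)"
proof -
  have i: "invertible2 \<sigma>1" "invertible2 \<sigma>2" "invertible2 \<sigma>1'" "invertible2 \<sigma>2'"
    using assms by (auto simp: datum_iso_def)
  note [simp] = i[THEN invertible2_cell]
  show ?thesis using assms by (auto simp: datum_iso_def datum_def lwhisker_vcomp)
qed

text \<open>When \<open>\<delta>\<close> is invertible, the defining equation can be solved for
  \<open>g2 \<triangleright> \<sigma>2\<close> in terms of \<open>\<sigma>1\<close>.\<close>

lemma datum_iso_determined:
  assumes "datum_iso g1 g2 X v1 v2 \<delta> v1' v2' \<delta>' \<sigma>1 \<sigma>2"
    and "datum_iso g1 g2 X v1 v2 \<delta> v1' v2' \<delta>' \<sigma>1 \<sigma>2'"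
    and "invertible2 \<delta>"
  shows "g2 \<triangleright> \<sigma>2 = g2 \<triangleright> \<sigma>2'"
proof (rule inv2_cancel_right[where \<alpha> = "\<delta> \<bullet> (g1 \<triangleright> \<sigma>1)"])
  have i: "invertible2 \<sigma>1" "invertible2 \<sigma>2" "invertible2 \<sigma>2'"
    using assms by (auto simp: datum_iso_def)
  note [simp] = i[THEN invertible2_cell]
  show "invertible2 (\<delta> \<bullet> (g1 \<triangleright> \<sigma>1))" "g2 \<triangleright> \<sigma>2 \<in> cell C" "g2 \<triangleright> \<sigma>2' \<in> cell C"
    "dom2 C (g2 \<triangleright> \<sigma>2) = cod2 C (\<delta> \<bullet> (g1 \<triangleright> \<sigma>1))" "dom2 C (g2 \<triangleright> \<sigma>2') = cod2 C (\<delta> \<bullet> (g1 \<triangleright> \<sigma>1))"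
    using assms by (auto simp: datum_iso_def datum_def)
  show "(g2 \<triangleright> \<sigma>2) \<bullet> (\<delta> \<bullet> (g1 \<triangleright> \<sigma>1)) = (g2 \<triangleright> \<sigma>2') \<bullet> (\<delta> \<bullet> (g1 \<triangleright> \<sigma>1))"
    using assms by (auto simp: datum_iso_def)
qed

lemma datum_restrict:
  assumes "datum g1 g2 X v1 v2 \<delta>" "z \<in> mor C" "src C z = Y" "trg C z = X"
  shows "datum g1 g2 Y (v1 \<odot> z) (v2 \<odot> z) (rwhisker_assoc C g1 v1 g2 v2 \<delta> z)"
  using assms by (simp add: datum_def)

text \<open>Restriction respects vertical composition, so it can be applied to the defining equation
  factor by factor; the outer factors remain whiskerings by \<open>g1\<close> and
  \<open>g2\<close>.\<close>

lemma datum_iso_restrict: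
  assumes "datum_iso g1 g2 X v1 v2 \<delta> v1' v2' \<delta>' \<sigma>1 \<sigma>2" "z \<in> mor C" "src C z = Y" "trg C z = X"
  shows "datum_iso g1 g2 Y (v1 \<odot> z) (v2 \<odot> z) (rwhisker_assoc C g1 v1 g2 v2 \<delta> z)
    (v1' \<odot> z) (v2' \<odot> z) (rwhisker_assoc C g1 v1' g2 v2' \<delta>' z) (\<sigma>1 \<triangleleft> z) (\<sigma>2 \<triangleleft> z)"
proof -
  have i: "invertible2 \<sigma>1" "invertible2 \<sigma>2" using assms by (auto simp: datum_iso_def)
  note [simp] = i[THEN invertible2_cell]
  have D: "datum g1 g2 X v1 v2 \<delta>" "datum g1 g2 X v1' v2' \<delta>'" "dom2 C \<sigma>1 = v1'" "cod2 C \<sigma>1 = v1"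
    "dom2 C \<sigma>2 = v2" "cod2 C \<sigma>2 = v2'"
    and eq: "\<delta>' = (g2 \<triangleright> \<sigma>2) \<bullet> (\<delta> \<bullet> (g1 \<triangleright> \<sigma>1))"
    using assms by (auto simp: datum_iso_def)
  have "rwhisker_assoc C g1 v1' g2 v2' \<delta>' z = rwhisker_assoc C g2 v2 g2 v2' (g2 \<triangleright> \<sigma>2) z \<bullet>
      (rwhisker_assoc C g1 v1 g2 v2 \<delta> z \<bullet> rwhisker_assoc C g1 v1' g1 v1 (g1 \<triangleright> \<sigma>1) z)"
    unfolding eq using D assms(2-) by (auto simp: datum_def rwhisker_assoc_vcomp)
  also have "rwhisker_assoc C g2 v2 g2 v2' (g2 \<triangleright> \<sigma>2) z = g2 \<triangleright> (\<sigma>2 \<triangleleft> z)"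
    using D assms(2-) by (intro rwhisker_assoc_lwhisker) (auto simp: datum_def)
  also have "rwhisker_assoc C g1 v1' g1 v1 (g1 \<triangleright> \<sigma>1) z = g1 \<triangleright> (\<sigma>1 \<triangleleft> z)"
    using D assms(2-) by (intro rwhisker_assoc_lwhisker) (auto simp: datum_def)
  finally have "rwhisker_assoc C g1 v1' g2 v2' \<delta>' z =
      (g2 \<triangleright> (\<sigma>2 \<triangleleft> z)) \<bullet> (rwhisker_assoc C g1 v1 g2 v2 \<delta> z \<bullet> (g1 \<triangleright> (\<sigma>1 \<triangleleft> z)))" .
  then show ?thesis using i D assms(2-)
    by (auto simp: datum_iso_def datum_restrict) (auto simp: datum_def)
qed

lemma datum_iso_restrict_comp1:
  assumes "datum g1 g2 X v1 v2 \<delta>" "z \<in> mor C" "trg C z = X" "u \<in> mor C" "src C u = Y" "trg C u = src C z"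
  shows "datum_iso g1 g2 Y (v1 \<odot> z \<odot> u) (v2 \<odot> z \<odot> u)
      (rwhisker_assoc C g1 (v1 \<odot> z) g2 (v2 \<odot> z) (rwhisker_assoc C g1 v1 g2 v2 \<delta> z) u)
    (v1 \<odot> (z \<odot> u)) (v2 \<odot> (z \<odot> u)) (rwhisker_assoc C g1 v1 g2 v2 \<delta> (z \<odot> u))
    (inv2 C (assoc C v1 z u)) (assoc C v2 z u)"
  using assms by (auto simp: datum_iso_def datum_def rwhisker_assoc_comp1)

lemma datum_iso_restrict_2cell:
  assumes "datum g1 g2 X v1 v2 \<delta>" "trg C z = X" "src C z = Y"
    "invertible2 \<zeta>" "dom2 C \<zeta> = z'" "cod2 C \<zeta> = z"
  shows "datum_iso g1 g2 Y (v1 \<odot> z) (v2 \<odot> z) (rwhisker_assoc C g1 v1 g2 v2 \<delta> z)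
    (v1 \<odot> z') (v2 \<odot> z') (rwhisker_assoc C g1 v1 g2 v2 \<delta> z')
    (v1 \<triangleright> \<zeta>) (v2 \<triangleright> inv2 C \<zeta>)"
proof -
  have \<zeta>: "\<zeta> \<in> cell C" using assms by (simp add: invertible2_cell)
  then have z: "z \<in> mor C" "z' \<in> mor C" "src C z' = src C z" "trg C z' = trg C z"
    using assms dom2_mor cod2_mor src_parallel[of \<zeta>] trg_parallel[of \<zeta>] by auto
  note [simp] = \<zeta> z assms
  have eq: "rwhisker_assoc C g1 v1 g2 v2 \<delta> z \<bullet> (g1 \<triangleright> v1 \<triangleright> \<zeta>) =
      (g2 \<triangleright> v2 \<triangleright> \<zeta>) \<bullet> rwhisker_assoc C g1 v1 g2 v2 \<delta> z'"
    using assms(1) by (intro rwhisker_assoc_2cell) (auto simp: datum_def)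
  have "(g2 \<triangleright> v2 \<triangleright> inv2 C \<zeta>) \<bullet> ((g2 \<triangleright> v2 \<triangleright> \<zeta>) \<bullet> rwhisker_assoc C g1 v1 g2 v2 \<delta> z') =
      rwhisker_assoc C g1 v1 g2 v2 \<delta> z'"
    using assms(1) inv2_cancel(1)[of "g2 \<triangleright> v2 \<triangleright> \<zeta>" "rwhisker_assoc C g1 v1 g2 v2 \<delta> z'"]
    by (auto simp: datum_def)
  then show ?thesis using assms(1) eq by (auto simp: datum_iso_def datum_def)
qed

text \<open>Restriction rebracketed so that the legs become \<open>p \<odot> (k \<odot> u)\<close>
  and \<open>q \<odot> (k \<odot> u)\<close>. Only in this form is the restriction of a pair
  \<open>(k, \<phi>)\<close> again a pair with a morphism into the same object.\<close>

definition rwhisker_inner :: "'m \<Rightarrow> 'm \<Rightarrow> 'm \<Rightarrow> 'm \<Rightarrow> 'm \<Rightarrow> 'c \<Rightarrow> 'm \<Rightarrow> 'c" where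
  "rwhisker_inner g1 p g2 q k \<delta> u = (g2 \<triangleright> assoc C q k u) \<bullet>
    (rwhisker_assoc C g1 (p \<odot> k) g2 (q \<odot> k) \<delta> u \<bullet> (g1 \<triangleright> inv2 C (assoc C p k u)))"

lemma datum_iso_rwhisker_inner:
  assumes "datum g1 g2 X (p \<odot> k) (q \<odot> k) \<delta>" "p \<in> mor C" "q \<in> mor C" "k \<in> mor C"
    "src C p = trg C k" "src C q = trg C k" "u \<in> mor C" "trg C u = X" "src C u = Y"
  shows "datum_iso g1 g2 Y (p \<odot> k \<odot> u) (q \<odot> k \<odot> u) (rwhisker_assoc C g1 (p \<odot> k) g2 (q \<odot> k) \<delta> u)
    (p \<odot> (k \<odot> u)) (q \<odot> (k \<odot> u)) (rwhisker_inner g1 p g2 q k \<delta> u)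
    (inv2 C (assoc C p k u)) (assoc C q k u)"
proof -
  have "src C k = X" using assms by (simp add: datum_def)
  then show ?thesis unfolding rwhisker_inner_def using assms
    by (intro datum_iso_transport datum_restrict) auto
qed

text \<open>Conjugating with the rebracketing isomorphisms turns the comparison cells into
  \<open>rwhisker_assoc\<close> of the old ones, which is precisely the expression that (BF4) says
  is a whiskering by an element of \<open>W\<close>.\<close>

lemma datum_iso_rwhisker_inner_cong:
  assumes "datum_iso g1 g2 X (p \<odot> k) (q \<odot> k) \<delta> (p \<odot> k') (q \<odot> k') \<delta>' \<sigma>1 \<sigma>2"
    "p \<in> mor C" "q \<in> mor C" "k \<in> mor C" "src C p = trg C k" "src C q = trg C k"
    "k' \<in> mor C" "trg C k' = trg C k" "u \<in> mor C" "trg C u = X" "src C u = Y"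
  shows "datum_iso g1 g2 Y (p \<odot> (k \<odot> u)) (q \<odot> (k \<odot> u)) (rwhisker_inner g1 p g2 q k \<delta> u)
    (p \<odot> (k' \<odot> u)) (q \<odot> (k' \<odot> u)) (rwhisker_inner g1 p g2 q k' \<delta>' u)
    (rwhisker_assoc C p k' p k \<sigma>1 u) (rwhisker_assoc C q k q k' \<sigma>2 u)"
proof -
  have \<sigma>: "datum g1 g2 X (p \<odot> k) (q \<odot> k) \<delta>" "datum g1 g2 X (p \<odot> k') (q \<odot> k') \<delta>'"
    "invertible2 \<sigma>1" "invertible2 \<sigma>2" "dom2 C \<sigma>1 = p \<odot> k'" "cod2 C \<sigma>1 = p \<odot> k"
    "dom2 C \<sigma>2 = q \<odot> k" "cod2 C \<sigma>2 = q \<odot> k'"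
    using assms(1) by (auto simp: datum_iso_def)
  have k: "src C k = X" "src C k' = X" using \<sigma> assms by (auto simp: datum_def)
  note [simp] = \<sigma>(3-) invertible2_cell[OF \<sigma>(3)] invertible2_cell[OF \<sigma>(4)] k assms(2-)
  note i = datum_iso_rwhisker_inner[OF \<sigma>(1), of u Y] datum_iso_rwhisker_inner[OF \<sigma>(2), of u Y]
  have "datum_iso g1 g2 Y (p \<odot> (k \<odot> u)) (q \<odot> (k \<odot> u)) (rwhisker_inner g1 p g2 q k \<delta> u)
    (p \<odot> (k' \<odot> u)) (q \<odot> (k' \<odot> u)) (rwhisker_inner g1 p g2 q k' \<delta>' u)
    (inv2 C (inv2 C (assoc C p k u)) \<bullet> (\<sigma>1 \<triangleleft> u) \<bullet> inv2 C (assoc C p k' u))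
    (assoc C q k' u \<bullet> ((\<sigma>2 \<triangleleft> u) \<bullet> inv2 C (assoc C q k u)))"
    by (rule datum_iso_trans[OF datum_iso_trans[OF datum_iso_sym[OF i(1)] datum_iso_restrict[OF assms(1)]] i(2)])
      simp_all
  then show ?thesis by (simp add: rwhisker_assoc_def)
qed

lemma rwhisker_inv2_cancel:
  assumes "invertible2 \<alpha>" "f \<in> mor C" "src C (dom2 C \<alpha>) = trg C f" "\<gamma> \<in> cell C"
    "cod2 C \<gamma> = cod2 C \<alpha> \<odot> f"
  shows "(\<alpha> \<triangleleft> f) \<bullet> ((inv2 C \<alpha> \<triangleleft> f) \<bullet> \<gamma>) = \<gamma>"
  using inv2_cancel(2)[of "\<alpha> \<triangleleft> f" \<gamma>] assms by (simp add: invertible2_cell)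

text \<open>The comparison of iterated with direct restriction is built from four associators of
  \<open>p\<close> (or \<open>q\<close>). Their composite must be a whiskering of a cell that
  involves neither, because one cell has to serve both legs; the pentagon provides this.\<close>

lemma pentagon_conj:
  assumes "f \<in> mor C" "g \<in> mor C" "h \<in> mor C" "k \<in> mor C"
    "src C g = trg C f" "src C h = trg C g" "src C k = trg C h"
  shows "assoc C k (h \<odot> g) f \<bullet> ((assoc C k h g \<triangleleft> f) \<bullet>
      (inv2 C (assoc C (k \<odot> h) g f) \<bullet> inv2 C (assoc C k h (g \<odot> f)))) = k \<triangleright> inv2 C (assoc C h g f)"
  using assms by (simp add: pentagon_inverse[symmetric] rwhisker_inv2_cancel)

lemma datum_iso_rwhisker_inner_comp1:
  assumes "datum g1 g2 X (p \<odot> k) (q \<odot> k) \<delta>" "p \<in> mor C" "q \<in> mor C" "k \<in> mor C"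
    "src C p = trg C k" "src C q = trg C k" "u \<in> mor C" "trg C u = X"
    "v \<in> mor C" "trg C v = src C u" "src C v = Y"
  shows "datum_iso g1 g2 Y (p \<odot> (k \<odot> u \<odot> v)) (q \<odot> (k \<odot> u \<odot> v))
      (rwhisker_inner g1 p g2 q (k \<odot> u) (rwhisker_inner g1 p g2 q k \<delta> u) v)
    (p \<odot> (k \<odot> (u \<odot> v))) (q \<odot> (k \<odot> (u \<odot> v))) (rwhisker_inner g1 p g2 q k \<delta> (u \<odot> v))
    (p \<triangleright> inv2 C (assoc C k u v)) (q \<triangleright> assoc C k u v)"
proof -
  have k: "src C k = X" using assms by (auto simp: datum_def)
  note [simp] = k assms(2-)
  have iu: "datum_iso g1 g2 (src C u) (p \<odot> k \<odot> u) (q \<odot> k \<odot> u) (rwhisker_assoc C g1 (p \<odot> k) g2 (q \<odot> k) \<delta> u)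
    (p \<odot> (k \<odot> u)) (q \<odot> (k \<odot> u)) (rwhisker_inner g1 p g2 q k \<delta> u)
    (inv2 C (assoc C p k u)) (assoc C q k u)"
    by (rule datum_iso_rwhisker_inner[OF assms(1)]) auto
  have iv: "datum_iso g1 g2 Y (p \<odot> (k \<odot> u) \<odot> v) (q \<odot> (k \<odot> u) \<odot> v)
      (rwhisker_assoc C g1 (p \<odot> (k \<odot> u)) g2 (q \<odot> (k \<odot> u)) (rwhisker_inner g1 p g2 q k \<delta> u) v)
    (p \<odot> (k \<odot> u \<odot> v)) (q \<odot> (k \<odot> u \<odot> v)) (rwhisker_inner g1 p g2 q (k \<odot> u) (rwhisker_inner g1 p g2 q k \<delta> u) v)
    (inv2 C (assoc C p (k \<odot> u) v)) (assoc C q (k \<odot> u) v)"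
    by (rule datum_iso_rwhisker_inner) (use iu in \<open>auto simp: datum_iso_def\<close>)
  have iuv: "datum_iso g1 g2 Y (p \<odot> k \<odot> (u \<odot> v)) (q \<odot> k \<odot> (u \<odot> v))
     (rwhisker_assoc C g1 (p \<odot> k) g2 (q \<odot> k) \<delta> (u \<odot> v))
    (p \<odot> (k \<odot> (u \<odot> v))) (q \<odot> (k \<odot> (u \<odot> v))) (rwhisker_inner g1 p g2 q k \<delta> (u \<odot> v))
    (inv2 C (assoc C p k (u \<odot> v))) (assoc C q k (u \<odot> v))"
    by (rule datum_iso_rwhisker_inner[OF assms(1)]) auto
  have r: "datum_iso g1 g2 Y (p \<odot> (k \<odot> u) \<odot> v) (q \<odot> (k \<odot> u) \<odot> v)
      (rwhisker_assoc C g1 (p \<odot> (k \<odot> u)) g2 (q \<odot> (k \<odot> u)) (rwhisker_inner g1 p g2 q k \<delta> u) v)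
    (p \<odot> k \<odot> u \<odot> v) (q \<odot> k \<odot> u \<odot> v)
      (rwhisker_assoc C g1 (p \<odot> k \<odot> u) g2 (q \<odot> k \<odot> u) (rwhisker_assoc C g1 (p \<odot> k) g2 (q \<odot> k) \<delta> u) v)
    (inv2 C (inv2 C (assoc C p k u)) \<triangleleft> v) (inv2 C (assoc C q k u) \<triangleleft> v)"
    by (rule datum_iso_restrict[OF datum_iso_sym[OF iu]]) auto
  have c: "datum_iso g1 g2 Y (p \<odot> k \<odot> u \<odot> v) (q \<odot> k \<odot> u \<odot> v)
      (rwhisker_assoc C g1 (p \<odot> k \<odot> u) g2 (q \<odot> k \<odot> u) (rwhisker_assoc C g1 (p \<odot> k) g2 (q \<odot> k) \<delta> u) v)
      (p \<odot> k \<odot> (u \<odot> v)) (q \<odot> k \<odot> (u \<odot> v)) (rwhisker_assoc C g1 (p \<odot> k) g2 (q \<odot> k) \<delta> (u \<odot> v))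
     (inv2 C (assoc C (p \<odot> k) u v)) (assoc C (q \<odot> k) u v)"
    by (rule datum_iso_restrict_comp1[OF assms(1)]) auto
  \<comment> \<open>On the second leg the four associators appear inverted, since second legs are
    compared in the opposite direction.\<close>
  have "inv2 C (assoc C q (k \<odot> u) v \<bullet> ((assoc C q k u \<triangleleft> v) \<bullet>
      (inv2 C (assoc C (q \<odot> k) u v) \<bullet> inv2 C (assoc C q k (u \<odot> v))))) = q \<triangleright> assoc C k u v"
    by (subst pentagon_conj) auto
  then show ?thesis
    using datum_iso_trans[OF datum_iso_trans[OF datum_iso_trans[OF datum_iso_sym[OF iv] r] c] iuv]
      pentagon_conj[of v u k p]
    by simp
qed

end

section \<open>Lifting along the class W\<close>

context bicategory_BF
begin

lemma W_in_mor [simp]: "w \<in> W \<Longrightarrow> w \<in> mor C"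
  using W_mor by blast

lemma W_comp1 [simp]: "v \<in> W \<Longrightarrow> w \<in> W \<Longrightarrow> src C w = trg C v \<Longrightarrow> w \<odot> v \<in> W"
  by (rule BF2)

text \<open>(BF5) applied to the cell and to its inverse.\<close>

lemma W_dom2_iff_cod2: "invertible2 \<alpha> \<Longrightarrow> dom2 C \<alpha> \<in> W \<longleftrightarrow> cod2 C \<alpha> \<in> W"
  using BF5[of "cod2 C \<alpha>" \<alpha> "dom2 C \<alpha>"] BF5[of "dom2 C \<alpha>" "inv2 C \<alpha>" "cod2 C \<alpha>"]
  by (auto simp: iso2_iff invertible2_cell)

lemma W_assoc:
  "f \<in> mor C \<Longrightarrow> g \<in> mor C \<Longrightarrow> h \<in> mor C \<Longrightarrow> src C g = trg C f \<Longrightarrow> src C h = trg C g \<Longrightarrow>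
    h \<odot> (g \<odot> f) \<in> W \<longleftrightarrow> h \<odot> g \<odot> f \<in> W"
  using W_dom2_iff_cod2[of "assoc C h g f"] by simp

lemma ore:
  assumes "w \<in> W" "f \<in> mor C" "trg C f = trg C w"
  obtains w' f' \<rho> where "w' \<in> W" "trg C w' = src C f" "f' \<in> mor C" "src C f' = src C w'"
    "trg C f' = src C w" "invertible2 \<rho>" "dom2 C \<rho> = f \<odot> w'" "cod2 C \<rho> = w \<odot> f'"
  using BF3[of w "src C w" "trg C w" f "src C f"] assms by (auto simp: iso2_iff hom_iff)

lemma lift_along_W:
  assumes "w \<in> W" "f \<in> mor C" "g \<in> mor C" "src C w = trg C f" "src C w = trg C g"
    "invertible2 \<alpha>" "dom2 C \<alpha> = w \<odot> f" "cod2 C \<alpha> = w \<odot> g"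
  obtains v \<beta> where "v \<in> W" "trg C v = src C f" "invertible2 \<beta>" "dom2 C \<beta> = f \<odot> v"
    "cod2 C \<beta> = g \<odot> v" "rwhisker_assoc C w f w g \<alpha> v = w \<triangleright> \<beta>"
proof -
  have c: "\<alpha> \<in> cell C" using assms by (simp add: invertible2_cell)
  have "src C g = src C f" using src_parallel[OF c] assms by simp
  then show ?thesis
    using BF4ab[of w "src C w" "trg C w" f "src C f" g \<alpha>] assms c that
    by (auto simp: BF4_triple_def iso2_iff hom_iff hom2_iff)
qed

text \<open>
  Two lifts of the same 2-cell along \<open>w\<close> are compared by (BF4c) with \<open>v = v' = id\<close>; the comparison
  cell \<open>\<zeta>\<close> cancels by naturality.
\<close>

lemma faithful_up_to_W:
  assumes "w \<in> W" "\<kappa> \<in> cell C" "\<kappa>' \<in> cell C" "dom2 C \<kappa> = f" "dom2 C \<kappa>' = f"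
    "cod2 C \<kappa> = g" "cod2 C \<kappa>' = g" "src C w = trg C f" "w \<triangleright> \<kappa> = w \<triangleright> \<kappa>'"
  obtains e where "e \<in> W" "trg C e = src C f" "\<kappa> \<triangleleft> e = \<kappa>' \<triangleleft> e"
proof -
  have m: "f \<in> mor C" "g \<in> mor C" "src C g = src C f" "trg C g = trg C f"
    using assms dom2_mor cod2_mor src_parallel[of \<kappa>] trg_parallel[of \<kappa>] by auto
  define i where "i = id1 C (src C f)"
  have i: "i \<in> W" "i \<in> mor C" "src C i = src C f" "trg C i = src C f"
    using m src_obj BF1 by (auto simp: i_def)
  note [simp] = m i assms(1-8)
  have "BF4_triple C W w f g (w \<triangleright> \<kappa>) (src C f) i (\<kappa> \<triangleleft> i)"
    "BF4_triple C W w f g (w \<triangleright> \<kappa>) (src C f) i (\<kappa>' \<triangleleft> i)"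
    using rwhisker_assoc_lwhisker[of \<kappa> f g w i] rwhisker_assoc_lwhisker[of \<kappa>' f g w i]
    by (auto simp: BF4_triple_def hom_iff hom2_iff assms(9))
  from BF4c[OF _ _ _ _ _ this, of "src C w" "trg C w" "src C f"] obtain u u' \<zeta> where
    u: "u \<in> mor C" "u' \<in> mor C" "trg C u = src C f" "trg C u' = src C f" "src C u = src C u'"
    and \<zeta>: "dom2 C \<zeta> = i \<odot> u" "cod2 C \<zeta> = i \<odot> u'" "invertible2 \<zeta>" and W: "i \<odot> u \<in> W"
    and eq: "rwhisker_assoc C f i g i (\<kappa>' \<triangleleft> i) u' \<bullet> (f \<triangleright> \<zeta>) =
      (g \<triangleright> \<zeta>) \<bullet> rwhisker_assoc C f i g i (\<kappa> \<triangleleft> i) u"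
    by (auto simp: hom_iff hom2_iff iso2_iff)
  note [simp] = u \<zeta> invertible2_cell[OF \<zeta>(3)]
  have rw: "rwhisker_assoc C f i g i (\<kappa> \<triangleleft> i) u = \<kappa> \<triangleleft> (i \<odot> u)"
    "rwhisker_assoc C f i g i (\<kappa>' \<triangleleft> i) u' = \<kappa>' \<triangleleft> (i \<odot> u')"
    by (simp_all add: rwhisker_assoc_def rwhisker_comp1[of \<kappa> f g] rwhisker_comp1[of \<kappa>' f g])
  have "(g \<triangleright> \<zeta>) \<bullet> (\<kappa>' \<triangleleft> (i \<odot> u)) = (g \<triangleright> \<zeta>) \<bullet> (\<kappa> \<triangleleft> (i \<odot> u))"
    using eq whisker_exchange[of \<zeta> \<kappa>'] by (simp add: rw)
  then have "\<kappa>' \<triangleleft> (i \<odot> u) = \<kappa> \<triangleleft> (i \<odot> u)"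
    by (rule inv2_cancel_left) simp_all
  then show ?thesis using that[of "i \<odot> u"] W by simp
qed

text \<open>Here \<open>b\<close> is only known to be in \<open>W\<close> after composition with
  \<open>w\<close>. So the square is formed for \<open>w \<odot> a\<close> over
  \<open>w \<odot> b\<close>, and the resulting 2-cell is lifted along \<open>w\<close>, at the
  price of one more restriction in \<open>W\<close>.\<close>

lemma ore_over_W:
  assumes "w \<in> W" "a \<in> mor C" "b \<in> mor C" "src C w = trg C a" "src C w = trg C b" "w \<odot> b \<in> W"
  obtains x y \<rho> where "x \<in> W" "y \<in> mor C" "trg C x = src C a" "trg C y = src C b" "src C y = src C x"
    "invertible2 \<rho>" "dom2 C \<rho> = a \<odot> x" "cod2 C \<rho> = b \<odot> y"
proof -
  note [simp] = assms(1-3,6) assms(4,5)[symmetric]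
  obtain x y \<theta> where x: "x \<in> W" "trg C x = src C (w \<odot> a)" "y \<in> mor C" "src C y = src C x"
    "trg C y = src C (w \<odot> b)"
    and \<theta>: "invertible2 \<theta>" "dom2 C \<theta> = w \<odot> a \<odot> x" "cod2 C \<theta> = w \<odot> b \<odot> y"
    by (rule ore[of "w \<odot> b" "w \<odot> a"]) auto
  note [simp] = x \<theta> invertible2_cell[OF \<theta>(1)]
  obtain v \<beta> where v: "v \<in> W" "trg C v = src C (a \<odot> x)" and
    \<beta>: "invertible2 \<beta>" "dom2 C \<beta> = a \<odot> x \<odot> v" "cod2 C \<beta> = b \<odot> y \<odot> v"
    by (rule lift_along_W[of w "a \<odot> x" "b \<odot> y"
          "assoc C w b y \<bullet> (\<theta> \<bullet> inv2 C (assoc C w a x))"]) auto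
  note [simp] = v \<beta> invertible2_cell[OF \<beta>(1)]
  show ?thesis
    by (rule that[of "x \<odot> v" "y \<odot> v" "assoc C b y v \<bullet> (\<beta> \<bullet> inv2 C (assoc C a x v))"]) auto
qed

text \<open>Close the cospan of an identity and \<open>z\<close> over \<open>w\<close>. The side
  opposite \<open>z\<close> is an identity composed with an element of \<open>W\<close>, so by (BF5)
  the isomorphic composite \<open>z \<odot> y\<close> is in \<open>W\<close> too.\<close>

lemma right_factor_into_W:
  assumes "w \<in> W" "z \<in> mor C" "src C w = trg C z" "w \<odot> z \<in> W"
  obtains s where "s \<in> mor C" "trg C s = src C z" "z \<odot> s \<in> W"
proof -
  note [simp] = assms(1,2,4) assms(3)[symmetric]
  have i: "id1 C (src C w) \<in> W" "id1 C (src C w) \<in> mor C" "src C (id1 C (src C w)) = src C w"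
    "trg C (id1 C (src C w)) = src C w"
    using src_obj[of w] BF1 by auto
  note [simp] = i
  obtain x y \<rho> where x: "x \<in> W" "y \<in> mor C" "trg C x = src C w" "trg C y = src C z"
    "invertible2 \<rho>" "dom2 C \<rho> = id1 C (src C w) \<odot> x" "cod2 C \<rho> = z \<odot> y"
    by (rule ore_over_W[of w "id1 C (src C w)" z]) auto
  have "z \<odot> y \<in> W" using W_dom2_iff_cod2[OF x(5)] x by simp
  then show ?thesis using that x by blast
qed

end

section \<open>2-morphisms in the sense of Pronk\<close>

locale frac_pair = bicategory_BF C W for C :: "('o, 'm, 'c) bicat" (structure) and W +
  fixes A B A1 A2 :: 'o and w1 f1 w2 f2 :: 'm
  assumes frac1: "(A1, w1, f1) \<in> frac_hom C W A B"
    and frac2: "(A2, w2, f2) \<in> frac_hom C W A B"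
begin

lemma frac_typing [simp]:
  "w1 \<in> W" "w2 \<in> W" "src C w1 = A1" "src C w2 = A2" "trg C w1 = A" "trg C w2 = A"
  "f1 \<in> mor C" "f2 \<in> mor C" "src C f1 = A1" "src C f2 = A2" "trg C f1 = B" "trg C f2 = B"
  using frac1 frac2 by (auto simp: frac_hom_def hom_iff)

section \<open>Pronk data, their isomorphisms and their restriction\<close>

definition fdatum :: "'o \<Rightarrow> 'm \<times> 'm \<times> 'c \<times> 'c \<Rightarrow> bool" where
  "fdatum X d = (case d of (v1, v2, \<alpha>, \<beta>) \<Rightarrow>
    datum w1 w2 X v1 v2 \<alpha> \<and> datum f1 f2 X v1 v2 \<beta> \<and> invertible2 \<alpha>)"

definition fiso :: "'o \<Rightarrow> 'm \<times> 'm \<times> 'c \<times> 'c \<Rightarrow> 'm \<times> 'm \<times> 'c \<times> 'c \<Rightarrow> bool" where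
  "fiso X d d' = (case d of (v1, v2, \<alpha>, \<beta>) \<Rightarrow> case d' of (v1', v2', \<alpha>', \<beta>') \<Rightarrow>
    invertible2 \<alpha> \<and> invertible2 \<alpha>' \<and>
    (\<exists>\<sigma>1 \<sigma>2. datum_iso w1 w2 X v1 v2 \<alpha> v1' v2' \<alpha>' \<sigma>1 \<sigma>2 \<and> datum_iso f1 f2 X v1 v2 \<beta> v1' v2' \<beta>' \<sigma>1 \<sigma>2))"

definition frestrict :: "'m \<times> 'm \<times> 'c \<times> 'c \<Rightarrow> 'm \<Rightarrow> 'm \<times> 'm \<times> 'c \<times> 'c" where
  "frestrict d z = (case d of (v1, v2, \<alpha>, \<beta>) \<Rightarrow>
    (v1 \<odot> z, v2 \<odot> z, rwhisker_assoc C w1 v1 w2 v2 \<alpha> z, rwhisker_assoc C f1 v1 f2 v2 \<beta> z))"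

abbreviation leg :: "'m \<times> 'm \<times> 'c \<times> 'c \<Rightarrow> 'm" where
  "leg d \<equiv> fst d"

lemma fdatum_leg:
  "fdatum X d \<Longrightarrow> leg d \<in> mor C \<and> src C (leg d) = X \<and> trg C (leg d) = A1"
  by (auto simp: fdatum_def datum_def)

lemma leg_frestrict [simp]: "leg (frestrict d z) = leg d \<odot> z"
  by (simp add: frestrict_def split: prod.splits)

lemma fiso_refl: "fdatum X d \<Longrightarrow> fiso X d d"
  using datum_iso_refl by (fastforce simp: fdatum_def fiso_def)

lemma fiso_sym: "fiso X d d' \<Longrightarrow> fiso X d' d"
  by (clarsimp simp: fiso_def) (blast intro: datum_iso_sym)

lemma fiso_trans: "fiso X d d' \<Longrightarrow> fiso X d' d'' \<Longrightarrow> fiso X d d''"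
  by (clarsimp simp: fiso_def split: prod.splits) (blast intro: datum_iso_trans)

lemma fiso_fdatum: "fiso X d d' \<Longrightarrow> fdatum X d \<and> fdatum X d'"
  by (auto simp: fiso_def fdatum_def datum_iso_def split: prod.splits)

lemma frestrict_invertible:
  "datum w1 w2 X v1 v2 \<alpha> \<Longrightarrow> invertible2 \<alpha> \<Longrightarrow> z \<in> mor C \<Longrightarrow> trg C z = X \<Longrightarrow>
    invertible2 (rwhisker_assoc C w1 v1 w2 v2 \<alpha> z)"
  by (auto simp: datum_def)

lemma fdatum_frestrict:
  "fdatum X d \<Longrightarrow> z \<in> mor C \<Longrightarrow> src C z = Y \<Longrightarrow> trg C z = X \<Longrightarrow> fdatum Y (frestrict d z)"
  by (auto simp: fdatum_def frestrict_def datum_restrict frestrict_invertible split: prod.splits)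

lemma fiso_frestrict:
  assumes "fiso X d d'" "z \<in> mor C" "src C z = Y" "trg C z = X"
  shows "fiso Y (frestrict d z) (frestrict d' z)"
proof -
  obtain v1 v2 \<alpha> \<beta> v1' v2' \<alpha>' \<beta>' where d: "d = (v1, v2, \<alpha>, \<beta>)" "d' = (v1', v2', \<alpha>', \<beta>')"
    by (metis prod_cases4)
  obtain \<sigma>1 \<sigma>2 where \<sigma>: "datum_iso w1 w2 X v1 v2 \<alpha> v1' v2' \<alpha>' \<sigma>1 \<sigma>2"
    "datum_iso f1 f2 X v1 v2 \<beta> v1' v2' \<beta>' \<sigma>1 \<sigma>2"
    using assms(1) by (auto simp: fiso_def d)
  from \<sigma>[THEN datum_iso_restrict, OF assms(2-)] fiso_fdatum[OF assms(1)] assms(2-)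
  show ?thesis by (auto simp: fiso_def frestrict_def d fdatum_def frestrict_invertible)
qed

lemma fiso_frestrict_comp1:
  assumes "fdatum X d" "z \<in> mor C" "trg C z = X" "u \<in> mor C" "src C u = Y" "trg C u = src C z"
  shows "fiso Y (frestrict (frestrict d z) u) (frestrict d (z \<odot> u))"
proof -
  obtain v1 v2 \<alpha> \<beta> where d: "d = (v1, v2, \<alpha>, \<beta>)" by (metis prod_cases4)
  have D: "datum w1 w2 X v1 v2 \<alpha>" "datum f1 f2 X v1 v2 \<beta>" using assms(1) by (auto simp: fdatum_def d)
  have "fdatum Y (frestrict (frestrict d z) u)" "fdatum Y (frestrict d (z \<odot> u))"
    using assms fdatum_frestrict[OF fdatum_frestrict[OF assms(1)]] fdatum_frestrict[OF assms(1)] by simp_all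
  then show ?thesis using D[THEN datum_iso_restrict_comp1, OF assms(2-)]
    by (auto simp: fiso_def frestrict_def d fdatum_def)
qed

lemma fiso_frestrict_2cell:
  assumes "fdatum X d" "trg C (cod2 C \<zeta>) = X" "src C (cod2 C \<zeta>) = Y" "invertible2 \<zeta>"
  shows "fiso Y (frestrict d (cod2 C \<zeta>)) (frestrict d (dom2 C \<zeta>))"
proof -
  obtain v1 v2 \<alpha> \<beta> where d: "d = (v1, v2, \<alpha>, \<beta>)" by (metis prod_cases4)
  have \<zeta>: "\<zeta> \<in> cell C" using assms by (simp add: invertible2_cell)
  have D: "datum w1 w2 X v1 v2 \<alpha>" "datum f1 f2 X v1 v2 \<beta>" using assms(1) by (auto simp: fdatum_def d)
  have "fdatum Y (frestrict d (cod2 C \<zeta>))" "fdatum Y (frestrict d (dom2 C \<zeta>))"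
    using fdatum_frestrict assms \<zeta> by (simp_all add: dom2_mor cod2_mor src_parallel trg_parallel)
  then show ?thesis using D[THEN datum_iso_restrict_2cell, OF assms(2-) refl refl]
    by (auto simp: fiso_def frestrict_def d fdatum_def)
qed

lemma fiso_leg_W:
  assumes "fiso X d d'" shows "w1 \<odot> leg d \<in> W \<longleftrightarrow> w1 \<odot> leg d' \<in> W"
proof -
  obtain \<sigma> where \<sigma>: "invertible2 \<sigma>" "cod2 C \<sigma> = leg d" "dom2 C \<sigma> = leg d'"
    using assms by (auto simp: fiso_def datum_iso_def)
  moreover have "leg d' \<in> mor C" "trg C (leg d') = A1"
    using fdatum_leg[of X d'] fiso_fdatum[OF assms] by auto
  ultimately show ?thesis
    using W_dom2_iff_cod2[of "w1 \<triangleright> \<sigma>"] invertible2_cell[OF \<sigma>(1)] by simp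
qed

definition fdatum_W :: "'o \<Rightarrow> 'm \<times> 'm \<times> 'c \<times> 'c \<Rightarrow> bool" where
  "fdatum_W X d \<longleftrightarrow> fdatum X d \<and> w1 \<odot> leg d \<in> W"

lemma frac_data_iff:
  "(X, d) \<in> frac_data C W (A1, w1, f1) (A2, w2, f2) \<longleftrightarrow> fdatum_W X d"
  by (auto simp: fdatum_W_def fdatum_def datum_def hom_iff hom2_iff iso2_iff split: prod.splits)

definition fequiv :: "'o \<Rightarrow> 'm \<times> 'm \<times> 'c \<times> 'c \<Rightarrow> 'o \<Rightarrow> 'm \<times> 'm \<times> 'c \<times> 'c \<Rightarrow> bool" where
  "fequiv X d Y e \<longleftrightarrow> fdatum_W X d \<and> fdatum_W Y e \<and>
    (\<exists>Z z z'. z \<in> hom C Z X \<and> z' \<in> hom C Z Y \<and> w1 \<odot> leg d \<odot> z \<in> W \<and>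
      fiso Z (frestrict d z) (frestrict e z'))"

lemma frac_equiv_iff:
  "((X, d), (Y, e)) \<in> frac_equiv C W (A1, w1, f1) (A2, w2, f2) \<longleftrightarrow> fequiv X d Y e"
proof -
  obtain v1 v2 \<alpha> \<beta> where d: "d = (v1, v2, \<alpha>, \<beta>)" by (metis prod_cases4)
  obtain v1' v2' \<alpha>' \<beta>' where e: "e = (v1', v2', \<alpha>', \<beta>')" by (metis prod_cases4)
  \<comment> \<open>Once both restrictions are known to be data, the typing conjuncts hidden in
    \<open>datum_iso\<close> hold automatically, and the two equations of Pronk's relation
    remain.\<close>
  have key: "fiso Z (frestrict d z) (frestrict e z') \<longleftrightarrow>
    (\<exists>\<sigma>1 \<sigma>2. \<sigma>1 \<in> iso2 C (v1' \<odot> z') (v1 \<odot> z) \<and> \<sigma>2 \<in> iso2 C (v2 \<odot> z) (v2' \<odot> z') \<and>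
        (w2 \<triangleright> \<sigma>2) \<bullet> rwhisker_assoc C w1 v1 w2 v2 \<alpha> z \<bullet> (w1 \<triangleright> \<sigma>1) =
          rwhisker_assoc C w1 v1' w2 v2' \<alpha>' z' \<and>
        (f2 \<triangleright> \<sigma>2) \<bullet> rwhisker_assoc C f1 v1 f2 v2 \<beta> z \<bullet> (f1 \<triangleright> \<sigma>1) =
          rwhisker_assoc C f1 v1' f2 v2' \<beta>' z')"
    if X: "fdatum X d" and Y: "fdatum Y e" and z: "z \<in> hom C Z X" "z' \<in> hom C Z Y" for Z z z'
  proof -
    have "fdatum Z (frestrict d z)" "fdatum Z (frestrict e z')"
      using fdatum_frestrict[OF X] fdatum_frestrict[OF Y] z by (auto simp: hom_iff)
    then show ?thesis
      by (simp only: fiso_def frestrict_def fdatum_def d e datum_iso_iff case_prod_conv simp_thms)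
        (intro iff_exI, blast)
  qed
  have "((X, d), (Y, e)) \<in> frac_equiv C W (A1, w1, f1) (A2, w2, f2) \<longleftrightarrow>
    (X, d) \<in> frac_data C W (A1, w1, f1) (A2, w2, f2) \<and> (Y, e) \<in> frac_data C W (A1, w1, f1) (A2, w2, f2) \<and>
    (\<exists>Z z z' \<sigma>1 \<sigma>2. z \<in> hom C Z X \<and> z' \<in> hom C Z Y \<and>
      \<sigma>1 \<in> iso2 C (v1' \<odot> z') (v1 \<odot> z) \<and> \<sigma>2 \<in> iso2 C (v2 \<odot> z) (v2' \<odot> z') \<and>
      w1 \<odot> v1 \<odot> z \<in> W \<and>
        (w2 \<triangleright> \<sigma>2) \<bullet> rwhisker_assoc C w1 v1 w2 v2 \<alpha> z \<bullet> (w1 \<triangleright> \<sigma>1) =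
          rwhisker_assoc C w1 v1' w2 v2' \<alpha>' z' \<and>
        (f2 \<triangleright> \<sigma>2) \<bullet> rwhisker_assoc C f1 v1 f2 v2 \<beta> z \<bullet> (f1 \<triangleright> \<sigma>1) =
          rwhisker_assoc C f1 v1' f2 v2' \<beta>' z')"
    unfolding d e by (simp only: frac_equiv.simps mem_Collect_eq case_prod_conv)
  also have "\<dots> \<longleftrightarrow> fequiv X d Y e"
    unfolding frac_data_iff fequiv_def
  proof (intro conj_cong refl iff_exI)
    fix Z z z' assume "fdatum_W X d" "fdatum_W Y e"
    then have de: "fdatum X d" "fdatum Y e" by (simp_all add: fdatum_W_def)
    have "leg d = v1" by (simp add: d)
    then show "(\<exists>\<sigma>1 \<sigma>2. z \<in> hom C Z X \<and> z' \<in> hom C Z Y \<and>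
      \<sigma>1 \<in> iso2 C (v1' \<odot> z') (v1 \<odot> z) \<and> \<sigma>2 \<in> iso2 C (v2 \<odot> z) (v2' \<odot> z') \<and>
      w1 \<odot> v1 \<odot> z \<in> W \<and>
        (w2 \<triangleright> \<sigma>2) \<bullet> rwhisker_assoc C w1 v1 w2 v2 \<alpha> z \<bullet> (w1 \<triangleright> \<sigma>1) =
          rwhisker_assoc C w1 v1' w2 v2' \<alpha>' z' \<and>
        (f2 \<triangleright> \<sigma>2) \<bullet> rwhisker_assoc C f1 v1 f2 v2 \<beta> z \<bullet> (f1 \<triangleright> \<sigma>1) =
          rwhisker_assoc C f1 v1' f2 v2' \<beta>' z') \<longleftrightarrow>
      z \<in> hom C Z X \<and> z' \<in> hom C Z Y \<and> w1 \<odot> leg d \<odot> z \<in> W \<and>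
      fiso Z (frestrict d z) (frestrict e z')"
      using key[OF de, of z Z z'] by blast
  qed
  finally show ?thesis .
qed

lemma fequivI:
  assumes "fdatum_W X d" "fdatum_W Y e" "z \<in> mor C" "z' \<in> mor C" "trg C z = X" "trg C z' = Y"
    "w1 \<odot> leg d \<odot> z \<in> W" "fiso (src C z) (frestrict d z) (frestrict e z')"
  shows "fequiv X d Y e"
proof -
  \<comment> \<open>Isomorphic data live over the same object, so the leg of the second restriction
    reveals the source of \<open>z'\<close>.\<close>
  have "src C z' = src C z"
    using fiso_fdatum[OF assms(8)] fdatum_leg[of Y e] fdatum_leg[of "src C z" "frestrict e z'"] assms(2-6)
    by (auto simp: fdatum_W_def)
  then show ?thesis using assms unfolding fequiv_def by (auto simp: hom_iff intro!: exI[of _ "src C z"])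
qed

text \<open>The relation itself only puts \<open>w1 \<odot> leg d \<odot> z\<close> in
  \<open>W\<close>. As \<open>w1 \<odot> leg d\<close> is in \<open>W\<close>, some
  \<open>z \<odot> s\<close> is in \<open>W\<close>, and restricting both data further along
  \<open>s\<close> yields a witness that meets the stronger requirement on almost canonical
  representatives.\<close>

lemma fequivE:
  assumes "fequiv X d Y e"
  obtains z z' where "z \<in> W" "z' \<in> mor C" "trg C z = X" "trg C z' = Y" "src C z' = src C z"
    "fiso (src C z) (frestrict d z) (frestrict e z')"
proof -
  obtain z z' where d: "fdatum_W X d" "fdatum_W Y e"
    and z: "z \<in> mor C" "trg C z = X" "z' \<in> mor C" "trg C z' = Y" "src C z' = src C z"
      "w1 \<odot> leg d \<odot> z \<in> W" and i: "fiso (src C z) (frestrict d z) (frestrict e z')"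
    using assms by (auto simp: fequiv_def hom_iff)
  have l: "leg d \<in> mor C" "src C (leg d) = X" "trg C (leg d) = A1" "w1 \<odot> leg d \<in> W" "fdatum X d" "fdatum Y e"
    using d fdatum_leg[of X d] by (auto simp: fdatum_W_def)
  note [simp] = z l
  obtain s where s: "s \<in> mor C" "trg C s = src C z" "z \<odot> s \<in> W"
    by (rule right_factor_into_W[of "w1 \<odot> leg d" z]) auto
  have "fiso (src C s) (frestrict d (z \<odot> s)) (frestrict e (z' \<odot> s))"
    using s fiso_frestrict[OF i, of s "src C s"]
      fiso_frestrict_comp1[of X d z s "src C s"] fiso_frestrict_comp1[of Y e z' s "src C s"]
    by (auto intro: fiso_trans fiso_sym)
  then show ?thesis using that[of "z \<odot> s" "z' \<odot> s"] s by simp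
qed

text \<open>Both data are restricted along the identity, and restriction preserves isomorphism; no
  comparison of \<open>frestrict d (id1 C X)\<close> with \<open>d\<close> arises.\<close>

lemma fiso_imp_fequiv:
  assumes "fiso X d e" "w1 \<odot> leg d \<in> W"
  shows "fequiv X d X e"
proof -
  have d: "fdatum X d" "fdatum X e" "fdatum_W X d" "fdatum_W X e"
    using fiso_fdatum[OF assms(1)] fiso_leg_W[OF assms(1)] assms(2) by (auto simp: fdatum_W_def)
  have l: "leg d \<in> mor C" "src C (leg d) = X" "trg C (leg d) = A1" using fdatum_leg[OF d(1)] by auto
  have i: "id1 C X \<in> W" "X \<in> obj C" using src_obj[OF l(1)] l BF1 by auto
  show ?thesis
  proof (rule fequivI)
    have "w1 \<odot> leg d \<odot> id1 C X \<in> W" using W_comp1[of "id1 C X" "w1 \<odot> leg d"] assms(2) i l by simp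
    then show "w1 \<odot> leg d \<odot> id1 C X \<in> W" .
    show "fiso (src C (id1 C X)) (frestrict d (id1 C X)) (frestrict e (id1 C X))"
      using fiso_frestrict[OF assms(1)] i by simp
  qed (use d i in auto)
qed

text \<open>The witnesses are the identity and \<open>z\<close> composed with the identity, so the
  required isomorphism is an instance of compatibility with composition.\<close>

lemma fequiv_frestrict:
  assumes "fdatum_W X d" "z \<in> mor C" "trg C z = X" "w1 \<odot> leg d \<odot> z \<in> W"
  shows "fequiv (src C z) (frestrict d z) X d"
proof -
  have d: "fdatum X d" "leg d \<in> mor C" "src C (leg d) = X" "trg C (leg d) = A1"
    using assms fdatum_leg[of X d] by (auto simp: fdatum_W_def)
  have i: "id1 C (src C z) \<in> W" "src C z \<in> obj C" using src_obj[of z] assms(2) BF1 by auto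
  have m': "w1 \<odot> (leg d \<odot> z) \<in> W" using W_assoc[of z "leg d" w1] d assms by simp
  show ?thesis
  proof (rule fequivI)
    show "w1 \<odot> leg (frestrict d z) \<odot> id1 C (src C z) \<in> W"
      using W_comp1[OF i(1) m'] i d assms by simp
    show "fiso (src C (id1 C (src C z))) (frestrict (frestrict d z) (id1 C (src C z)))
      (frestrict d (z \<odot> id1 C (src C z)))"
      using fiso_frestrict_comp1[OF d(1)] assms i by simp
    show "fdatum_W (src C z) (frestrict d z)"
      using fdatum_frestrict[OF d(1)] m' assms by (simp add: fdatum_W_def)
  qed (use assms i in auto)
qed

text \<open>The condition on \<open>W\<close> mentions the first datum only; it passes to the second
  because the two restricted first legs are isomorphic and (BF5) holds.\<close>

lemma fequiv_sym:
  assumes "fequiv X d Y e" shows "fequiv Y e X d"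
proof -
  have de: "fdatum X d" "fdatum Y e" "fdatum_W X d" "fdatum_W Y e" "w1 \<odot> leg d \<in> W"
    using assms by (auto simp: fequiv_def fdatum_W_def)
  obtain z z' where z: "z \<in> W" "z' \<in> mor C" "trg C z = X" "trg C z' = Y" "src C z' = src C z"
    and i: "fiso (src C z) (frestrict d z) (frestrict e z')"
    by (rule fequivE[OF assms])
  note [simp] = z
  have l: "leg d \<in> mor C" "src C (leg d) = X" "trg C (leg d) = A1"
    "leg e \<in> mor C" "src C (leg e) = Y" "trg C (leg e) = A1" using fdatum_leg[OF de(1)] fdatum_leg[OF de(2)] by auto
  have "w1 \<odot> (leg d \<odot> z) \<in> W" using W_assoc[of z "leg d" w1] W_comp1[of z "w1 \<odot> leg d"] l de by simp
  then have "w1 \<odot> leg e \<odot> z' \<in> W" using fiso_leg_W[OF i] W_assoc[of z' "leg e" w1] l by simp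
  then show ?thesis using de fiso_sym[OF i] by (intro fequivI[of Y e X d z' z]) auto
qed

lemma fequiv_trans:
  assumes "fequiv X d Y e" "fequiv Y e Z g" shows "fequiv X d Z g"
proof -
  have D: "fdatum X d" "fdatum Y e" "fdatum Z g" "fdatum_W X d" "fdatum_W Y e" "fdatum_W Z g"
    "w1 \<odot> leg d \<in> W" "w1 \<odot> leg e \<in> W"
    using assms by (auto simp: fequiv_def fdatum_W_def)
  have l: "leg d \<in> mor C" "src C (leg d) = X" "trg C (leg d) = A1"
    "leg e \<in> mor C" "src C (leg e) = Y" "trg C (leg e) = A1" using fdatum_leg[OF D(1)] fdatum_leg[OF D(2)] by auto
  obtain z z' where z: "z \<in> W" "z' \<in> mor C" "trg C z = X" "trg C z' = Y" "src C z' = src C z"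
    and i: "fiso (src C z) (frestrict d z) (frestrict e z')"
    by (rule fequivE[OF assms(1)])
  obtain y y' where y: "y \<in> W" "y' \<in> mor C" "trg C y = Y" "trg C y' = Z" "src C y' = src C y"
    and j: "fiso (src C y) (frestrict e y) (frestrict g y')"
    by (rule fequivE[OF assms(2)])
  note [simp] = z y l D(7,8)
  \<comment> \<open>A square over the middle object \<open>Y\<close> makes the two restrictions of
    \<open>e\<close> comparable. Its side \<open>a\<close> is in \<open>W\<close>, hence so is the
    new witness \<open>z \<odot> a\<close>.\<close>
  obtain a b \<rho> where a: "a \<in> W" "b \<in> mor C" "trg C a = src C z" "trg C b = src C y" "src C b = src C a"
    and \<rho>: "invertible2 \<rho>" "dom2 C \<rho> = z' \<odot> a" "cod2 C \<rho> = y \<odot> b"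
    by (rule ore_over_W[of "w1 \<odot> leg e" z' y]) auto
  note [simp] = a
  have r: "fiso (src C a) (frestrict e (y \<odot> b)) (frestrict e (z' \<odot> a))"
    using fiso_frestrict_2cell[OF D(2), of \<rho> "src C a"] \<rho> by simp
  have 1: "fiso (src C a) (frestrict d (z \<odot> a)) (frestrict e (z' \<odot> a))"
    using fiso_frestrict[OF i, of a "src C a"] fiso_frestrict_comp1[OF D(1), of z a "src C a"]
      fiso_frestrict_comp1[OF D(2), of z' a "src C a"] by (auto intro: fiso_trans fiso_sym)
  have 2: "fiso (src C a) (frestrict e (y \<odot> b)) (frestrict g (y' \<odot> b))"
    using fiso_frestrict[OF j, of b "src C a"] fiso_frestrict_comp1[OF D(2), of y b "src C a"]
      fiso_frestrict_comp1[OF D(3), of y' b "src C a"] by (auto intro: fiso_trans fiso_sym)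
  have "fiso (src C a) (frestrict d (z \<odot> a)) (frestrict g (y' \<odot> b))"
    using 1 2 r fiso_trans fiso_sym by blast
  then show ?thesis using D by (intro fequivI[of X d Z g "z \<odot> a" "y' \<odot> b"]) auto
qed

lemma equiv_frac_equiv:
  "equiv (frac_data C W (A1, w1, f1) (A2, w2, f2)) (frac_equiv C W (A1, w1, f1) (A2, w2, f2))"
proof (rule equivI)
  show "refl_on (frac_data C W (A1, w1, f1) (A2, w2, f2)) (frac_equiv C W (A1, w1, f1) (A2, w2, f2))"
    using fiso_imp_fequiv fiso_refl
    by (auto simp only: refl_on_def split_paired_all frac_data_iff frac_equiv_iff) (auto simp: fdatum_W_def)
  show "frac_equiv C W (A1, w1, f1) (A2, w2, f2) \<subseteq> frac_data C W (A1, w1, f1) (A2, w2, f2) \<times> frac_data C W (A1, w1, f1) (A2, w2, f2)"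
    by (auto simp only: subset_iff split_paired_all frac_data_iff frac_equiv_iff mem_Times_iff fequiv_def fst_conv snd_conv)
  show "sym (frac_equiv C W (A1, w1, f1) (A2, w2, f2))"
    by (rule symI) (use fequiv_sym in \<open>auto simp only: split_paired_all frac_equiv_iff\<close>)
  show "trans (frac_equiv C W (A1, w1, f1) (A2, w2, f2))"
    by (rule transI) (use fequiv_trans in \<open>auto simp only: split_paired_all frac_equiv_iff\<close>)
qed

end

section \<open>Almost canonical representatives\<close>

locale frac_choice = frac_pair C W A B A1 A2 w1 f1 w2 f2
  for C :: "('o, 'm, 'c) bicat" (structure) and W A B A1 A2 w1 f1 w2 f2 +
  fixes E p q \<tau>
  assumes p: "p \<in> W" "p \<in> hom C E A1"
    and q: "q \<in> hom C E A2"
    and \<tau>: "\<tau> \<in> iso2 C (w1 \<odot> p) (w2 \<odot> q)"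
begin

lemma choice_typing [simp]:
  "p \<in> W" "q \<in> mor C" "src C p = E" "src C q = E" "trg C p = A1" "trg C q = A2"
  "\<tau> \<in> cell C" "dom2 C \<tau> = w1 \<odot> p" "cod2 C \<tau> = w2 \<odot> q" "invertible2 \<tau>"
  using p q \<tau> by (auto simp: hom_iff iso2_iff)

lemma datum_choice: "datum w1 w2 E p q \<tau>"
  by (simp add: datum_def)

definition adatum :: "'o \<Rightarrow> 'm \<times> 'c \<Rightarrow> bool" where
  "adatum X x = (case x of (k, \<phi>) \<Rightarrow> k \<in> hom C X E \<and> datum f1 f2 X (p \<odot> k) (q \<odot> k) \<phi>)"

text \<open>Stricter than an isomorphism of the images under \<open>fcan\<close>: the comparisons of
  both legs must come from one 2-cell between the morphisms into \<open>E\<close>.\<close>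

definition aiso :: "'o \<Rightarrow> 'm \<times> 'c \<Rightarrow> 'm \<times> 'c \<Rightarrow> bool" where
  "aiso X x x' = (case x of (k, \<phi>) \<Rightarrow> case x' of (k', \<phi>') \<Rightarrow>
    adatum X (k, \<phi>) \<and> adatum X (k', \<phi>') \<and> (\<exists>\<sigma>. invertible2 \<sigma> \<and> dom2 C \<sigma> = k' \<and> cod2 C \<sigma> = k \<and>
      datum_iso f1 f2 X (p \<odot> k) (q \<odot> k) \<phi> (p \<odot> k') (q \<odot> k') \<phi>' (p \<triangleright> \<sigma>) (q \<triangleright> inv2 C \<sigma>)))"

definition arestrict :: "'m \<times> 'c \<Rightarrow> 'm \<Rightarrow> 'm \<times> 'c" where
  "arestrict x u = (case x of (k, \<phi>) \<Rightarrow> (k \<odot> u, rwhisker_inner f1 p f2 q k \<phi> u))"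

definition fcan :: "'m \<times> 'c \<Rightarrow> 'm \<times> 'm \<times> 'c \<times> 'c" where
  "fcan x = (case x of (k, \<phi>) \<Rightarrow> (p \<odot> k, q \<odot> k, rwhisker_assoc C w1 p w2 q \<tau> k, \<phi>))"

lemma adatum_arestrict:
  assumes "adatum X x" "u \<in> mor C" "trg C u = X" "src C u = Y"
  shows "adatum Y (arestrict x u)"
proof -
  obtain k \<phi> where x: "x = (k, \<phi>)" by (cases x)
  have k: "k \<in> mor C" "src C k = X" "trg C k = E" and D: "datum f1 f2 X (p \<odot> k) (q \<odot> k) \<phi>"
    using assms(1) by (auto simp: adatum_def x hom_iff)
  show ?thesis using datum_iso_rwhisker_inner[OF D _ _ k(1), of u Y] k assms(2-)
    by (auto simp: adatum_def x arestrict_def hom_iff datum_iso_def)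
qed

lemma aiso_sym:
  assumes "aiso X x y" shows "aiso X y x"
proof -
  obtain k \<phi> k' \<phi>' where xy: "x = (k, \<phi>)" "y = (k', \<phi>')" by (metis surj_pair)
  obtain \<sigma> where \<sigma>: "adatum X x" "adatum X y" "invertible2 \<sigma>" "dom2 C \<sigma> = k'" "cod2 C \<sigma> = k"
    and i: "datum_iso f1 f2 X (p \<odot> k) (q \<odot> k) \<phi> (p \<odot> k') (q \<odot> k') \<phi>' (p \<triangleright> \<sigma>) (q \<triangleright> inv2 C \<sigma>)"
    using assms by (auto simp: aiso_def xy)
  have "trg C k = E" "trg C k' = E" using \<sigma> by (auto simp: adatum_def xy hom_iff)
  with datum_iso_sym[OF i] \<sigma> show ?thesis by (auto simp: aiso_def xy intro!: exI[of _ "inv2 C \<sigma>"])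
qed

lemma aiso_trans:
  assumes "aiso X x y" "aiso X y z" shows "aiso X x z"
proof -
  obtain k \<phi> k' \<phi>' k'' \<phi>'' where xyz: "x = (k, \<phi>)" "y = (k', \<phi>')" "z = (k'', \<phi>'')" by (metis surj_pair)
  obtain \<sigma> where \<sigma>: "adatum X x" "adatum X y" "invertible2 \<sigma>" "dom2 C \<sigma> = k'" "cod2 C \<sigma> = k"
    and i: "datum_iso f1 f2 X (p \<odot> k) (q \<odot> k) \<phi> (p \<odot> k') (q \<odot> k') \<phi>' (p \<triangleright> \<sigma>) (q \<triangleright> inv2 C \<sigma>)"
    using assms(1) by (auto simp: aiso_def xyz)
  obtain \<rho> where \<rho>: "adatum X z" "invertible2 \<rho>" "dom2 C \<rho> = k''" "cod2 C \<rho> = k'"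
    and j: "datum_iso f1 f2 X (p \<odot> k') (q \<odot> k') \<phi>' (p \<odot> k'') (q \<odot> k'') \<phi>'' (p \<triangleright> \<rho>) (q \<triangleright> inv2 C \<rho>)"
    using assms(2) by (auto simp: aiso_def xyz)
  have "trg C k = E" "trg C k' = E" "trg C k'' = E" using \<sigma> \<rho> by (auto simp: adatum_def xyz hom_iff)
  note [simp] = this \<sigma>(3-) \<rho>(2-) invertible2_cell[OF \<sigma>(3)] invertible2_cell[OF \<rho>(2)]
  show ?thesis using datum_iso_trans[OF i j] \<sigma>(1) \<rho>(1)
    by (auto simp: aiso_def xyz lwhisker_vcomp intro!: exI[of _ "\<sigma> \<bullet> \<rho>"])
qed

lemma aiso_arestrict_comp1:
  assumes "adatum X x" "u \<in> mor C" "trg C u = X" "v \<in> mor C" "trg C v = src C u" "src C v = Y"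
  shows "aiso Y (arestrict (arestrict x u) v) (arestrict x (u \<odot> v))"
proof -
  obtain k \<phi> where x: "x = (k, \<phi>)" by (cases x)
  have k: "k \<in> mor C" "src C k = X" "trg C k = E" and D: "datum f1 f2 X (p \<odot> k) (q \<odot> k) \<phi>"
    using assms(1) by (auto simp: adatum_def x hom_iff)
  note [simp] = k assms(2-)
  have "adatum Y (arestrict (arestrict x u) v)" "adatum Y (arestrict x (u \<odot> v))"
    using adatum_arestrict[OF adatum_arestrict[OF assms(1)], of u "src C u" v Y]
      adatum_arestrict[OF assms(1), of "u \<odot> v" Y] by auto
  moreover have "datum_iso f1 f2 Y (p \<odot> (k \<odot> u \<odot> v)) (q \<odot> (k \<odot> u \<odot> v))
      (rwhisker_inner f1 p f2 q (k \<odot> u) (rwhisker_inner f1 p f2 q k \<phi> u) v)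
    (p \<odot> (k \<odot> (u \<odot> v))) (q \<odot> (k \<odot> (u \<odot> v))) (rwhisker_inner f1 p f2 q k \<phi> (u \<odot> v))
    (p \<triangleright> inv2 C (assoc C k u v)) (q \<triangleright> assoc C k u v)"
    by (rule datum_iso_rwhisker_inner_comp1[OF D]) auto
  ultimately show ?thesis
    by (auto simp: aiso_def x arestrict_def intro!: exI[of _ "inv2 C (assoc C k u v)"])
qed

text \<open>With the inner bracketing, the component coming from \<open>\<tau>\<close> commutes with
  restriction strictly, so only the component \<open>\<phi>\<close> has to be tracked.\<close>

lemma rwhisker_inner_choice:
  assumes "k \<in> mor C" "trg C k = E" "u \<in> mor C" "trg C u = src C k"
  shows "rwhisker_inner w1 p w2 q k (rwhisker_assoc C w1 p w2 q \<tau> k) u = rwhisker_assoc C w1 p w2 q \<tau> (k \<odot> u)"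
  using assms by (simp add: rwhisker_inner_def rwhisker_assoc_comp1)

lemma fdatum_fcan: "adatum X x \<Longrightarrow> fdatum X (fcan x)"
  using datum_restrict[OF datum_choice]
  by (auto simp: adatum_def fdatum_def fcan_def hom_iff)

text \<open>The rebracketing associators are the same for the pair \<open>w1\<close>,
  \<open>w2\<close> and the pair \<open>f1\<close>, \<open>f2\<close>, so they form one isomorphism
  of Pronk data.\<close>

lemma fiso_fcan_arestrict:
  assumes "adatum X x" "u \<in> mor C" "trg C u = X" "src C u = Y"
  shows "fiso Y (frestrict (fcan x) u) (fcan (arestrict x u))"
proof -
  obtain k \<phi> where x: "x = (k, \<phi>)" by (cases x)
  have k: "k \<in> mor C" "src C k = X" "trg C k = E" and D: "datum f1 f2 X (p \<odot> k) (q \<odot> k) \<phi>"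
    using assms(1) by (auto simp: adatum_def x hom_iff)
  note [simp] = k assms(2-)
  have D': "datum w1 w2 X (p \<odot> k) (q \<odot> k) (rwhisker_assoc C w1 p w2 q \<tau> k)"
    by (rule datum_restrict[OF datum_choice]) auto
  show ?thesis
    using datum_iso_rwhisker_inner[OF D, of u Y] datum_iso_rwhisker_inner[OF D', of u Y]
    by (auto simp: fiso_def frestrict_def fcan_def arestrict_def x rwhisker_inner_choice)
qed

text \<open>For the component coming from \<open>\<tau>\<close>, compatibility with
  \<open>\<sigma>\<close> is automatic: it is naturality of restricting \<open>\<tau>\<close> along
  a 2-cell.\<close>

lemma aiso_imp_fiso_fcan:
  assumes "aiso X x y" shows "fiso X (fcan x) (fcan y)"
proof -
  obtain k \<phi> k' \<phi>' where xy: "x = (k, \<phi>)" "y = (k', \<phi>')" by (metis surj_pair)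
  obtain \<sigma> where \<sigma>: "adatum X x" "adatum X y" "invertible2 \<sigma>" "dom2 C \<sigma> = k'" "cod2 C \<sigma> = k"
    and i: "datum_iso f1 f2 X (p \<odot> k) (q \<odot> k) \<phi> (p \<odot> k') (q \<odot> k') \<phi>' (p \<triangleright> \<sigma>) (q \<triangleright> inv2 C \<sigma>)"
    using assms by (auto simp: aiso_def xy)
  have k: "k \<in> mor C" "src C k = X" "trg C k = E" "k' \<in> mor C" "src C k' = X" "trg C k' = E"
    using \<sigma> by (auto simp: adatum_def xy hom_iff)
  show ?thesis using i datum_iso_restrict_2cell[OF datum_choice k(3,2) \<sigma>(3-)] k
    by (auto simp: fiso_def fcan_def xy)
qed

text \<open>
  The first component of the isomorphism descends along \<open>p\<close> to a 2-cell \<open>\<rho>\<close>; the compatibility with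
  \<open>\<tau>\<close> then forces the second component to be \<open>q \<triangleright> inv2 C \<rho>\<close>
  after whiskering with \<open>w2\<close>, hence after restriction along some \<open>e \<in> W\<close>.
\<close>

lemma fiso_fcan_imp_aiso:
  assumes "adatum X x" "adatum X y" "fiso X (fcan x) (fcan y)"
  obtains r where "r \<in> W" "trg C r = X" "aiso (src C r) (arestrict x r) (arestrict y r)"
proof -
  obtain k \<phi> k' \<phi>' where xy: "x = (k, \<phi>)" "y = (k', \<phi>')" by (metis surj_pair)
  obtain \<sigma>1 \<sigma>2 where
    i: "datum_iso w1 w2 X (p \<odot> k) (q \<odot> k) (rwhisker_assoc C w1 p w2 q \<tau> k)
      (p \<odot> k') (q \<odot> k') (rwhisker_assoc C w1 p w2 q \<tau> k') \<sigma>1 \<sigma>2"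
    and j: "datum_iso f1 f2 X (p \<odot> k) (q \<odot> k) \<phi> (p \<odot> k') (q \<odot> k') \<phi>' \<sigma>1 \<sigma>2"
    using assms(3) by (auto simp: fiso_def fcan_def xy)
  have k: "k \<in> mor C" "src C k = X" "trg C k = E" "k' \<in> mor C" "src C k' = X" "trg C k' = E"
    using assms(1,2) by (auto simp: adatum_def xy hom_iff)
  have \<sigma>: "invertible2 \<sigma>1" "invertible2 \<sigma>2" "dom2 C \<sigma>1 = p \<odot> k'" "cod2 C \<sigma>1 = p \<odot> k"
    "dom2 C \<sigma>2 = q \<odot> k" "cod2 C \<sigma>2 = q \<odot> k'"
    using j by (auto simp: datum_iso_def)
  note [simp] = k \<sigma> invertible2_cell[OF \<sigma>(1)] invertible2_cell[OF \<sigma>(2)]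
  obtain v \<rho> where v: "v \<in> W" "trg C v = X" and \<rho>: "invertible2 \<rho>" "dom2 C \<rho> = k' \<odot> v"
    "cod2 C \<rho> = k \<odot> v" and eq: "rwhisker_assoc C p k' p k \<sigma>1 v = p \<triangleright> \<rho>"
    by (rule lift_along_W[of p k' k \<sigma>1]) auto
  note [simp] = v \<rho> invertible2_cell[OF \<rho>(1)]
  define \<kappa> where "\<kappa> = rwhisker_assoc C q k q k' \<sigma>2 v"
  have \<kappa>: "\<kappa> \<in> cell C" "invertible2 \<kappa>" "dom2 C \<kappa> = q \<odot> (k \<odot> v)" "cod2 C \<kappa> = q \<odot> (k' \<odot> v)"
    by (simp_all add: \<kappa>_def)
  note [simp] = \<kappa>
  have iv: "datum_iso w1 w2 (src C v) (p \<odot> (k \<odot> v)) (q \<odot> (k \<odot> v)) (rwhisker_assoc C w1 p w2 q \<tau> (k \<odot> v))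
      (p \<odot> (k' \<odot> v)) (q \<odot> (k' \<odot> v)) (rwhisker_assoc C w1 p w2 q \<tau> (k' \<odot> v)) (p \<triangleright> \<rho>) \<kappa>"
    using datum_iso_rwhisker_inner_cong[OF i, of v "src C v"] by (simp add: eq \<kappa>_def rwhisker_inner_choice)
  have jv: "datum_iso f1 f2 (src C v) (p \<odot> (k \<odot> v)) (q \<odot> (k \<odot> v)) (rwhisker_inner f1 p f2 q k \<phi> v)
      (p \<odot> (k' \<odot> v)) (q \<odot> (k' \<odot> v)) (rwhisker_inner f1 p f2 q k' \<phi>' v) (p \<triangleright> \<rho>) \<kappa>"
    using datum_iso_rwhisker_inner_cong[OF j, of v "src C v"] by (simp add: eq \<kappa>_def)
  \<comment> \<open>Two isomorphisms between the same restrictions of \<open>\<tau>\<close> share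
    the first component \<open>p \<triangleright> \<rho>\<close>: the one in \<open>iv\<close>, and
    the one that \<open>\<rho>\<close> induces by naturality.\<close>
  have w2: "w2 \<triangleright> \<kappa> = w2 \<triangleright> (q \<triangleright> inv2 C \<rho>)"
    by (rule datum_iso_determined[OF iv datum_iso_restrict_2cell[OF datum_choice]]) auto
  obtain e where e: "e \<in> W" "trg C e = src C v" and \<kappa>e: "\<kappa> \<triangleleft> e = (q \<triangleright> inv2 C \<rho>) \<triangleleft> e"
    by (rule faithful_up_to_W[OF _ _ _ _ _ _ _ _ w2]) auto
  note [simp] = e
  have rw: "rwhisker_assoc C p (k' \<odot> v) p (k \<odot> v) (p \<triangleright> \<rho>) e = p \<triangleright> (\<rho> \<triangleleft> e)"
    "rwhisker_assoc C q (k \<odot> v) q (k' \<odot> v) (q \<triangleright> inv2 C \<rho>) e = q \<triangleright> (inv2 C \<rho> \<triangleleft> e)"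
    by (rule rwhisker_assoc_lwhisker; simp)+
  \<comment> \<open>Along \<open>e\<close> the second comparison becomes \<open>q\<close> whiskered
    with the inverse of \<open>\<rho> \<triangleleft> e\<close>, so the single 2-cell
    \<open>\<rho> \<triangleleft> e\<close> witnesses \<open>aiso\<close>.\<close>
  have rw': "rwhisker_assoc C q (k \<odot> v) q (k' \<odot> v) \<kappa> e = q \<triangleright> (inv2 C \<rho> \<triangleleft> e)"
    using rw(2) by (simp add: rwhisker_assoc_def \<kappa>e)
  have x: "adatum (src C v) (arestrict x v)" "adatum (src C v) (arestrict y v)"
    using adatum_arestrict[OF assms(1), of v] adatum_arestrict[OF assms(2), of v] by auto
  have "aiso (src C e) (arestrict (arestrict x v) e) (arestrict (arestrict y v) e)"
    using datum_iso_rwhisker_inner_cong[OF jv, of e "src C e"]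
      adatum_arestrict[OF x(1), of e "src C e"] adatum_arestrict[OF x(2), of e "src C e"]
    by (auto simp: aiso_def arestrict_def xy rw(1) rw' intro!: exI[of _ "\<rho> \<triangleleft> e"])
  moreover have "aiso (src C e) (arestrict (arestrict x v) e) (arestrict x (v \<odot> e))"
    "aiso (src C e) (arestrict (arestrict y v) e) (arestrict y (v \<odot> e))"
    using aiso_arestrict_comp1 assms by simp_all
  ultimately have "aiso (src C e) (arestrict x (v \<odot> e)) (arestrict y (v \<odot> e))"
    by (blast intro: aiso_trans aiso_sym)
  then show ?thesis using that[of "v \<odot> e"] by simp
qed

section \<open>Comparison of the two relations, and essential surjectivity of
  \<open>fcan\<close>\<close>

definition adatum_W :: "'o \<Rightarrow> 'm \<times> 'c \<Rightarrow> bool" where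
  "adatum_W X x \<longleftrightarrow> adatum X x \<and> fst x \<in> W"

definition aequiv :: "'o \<Rightarrow> 'm \<times> 'c \<Rightarrow> 'o \<Rightarrow> 'm \<times> 'c \<Rightarrow> bool" where
  "aequiv X x Y y \<longleftrightarrow> adatum_W X x \<and> adatum_W Y y \<and>
    (\<exists>Z u u'. u \<in> W \<and> u \<in> hom C Z X \<and> u' \<in> hom C Z Y \<and> aiso Z (arestrict x u) (arestrict y u'))"

lemma fdatum_W_fcan: "adatum_W X x \<Longrightarrow> fdatum_W X (fcan x)"
proof -
  assume x: "adatum_W X x"
  then obtain k \<phi> where k: "x = (k, \<phi>)" "k \<in> W" "trg C k = E" by (cases x) (auto simp: adatum_W_def adatum_def hom_iff)
  have "w1 \<odot> (p \<odot> k) \<in> W" using k by simp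
  then show ?thesis using x fdatum_fcan by (auto simp: fdatum_W_def adatum_W_def fcan_def k)
qed

text \<open>Left to right, \<open>fcan\<close> commutes with restriction and preserves isomorphism.
  Right to left, the witness \<open>z\<close> may be taken in \<open>W\<close>, and reflecting the
  isomorphism costs a restriction along some \<open>r\<close> in \<open>W\<close>; the composite
  \<open>z \<odot> r\<close> is then still in \<open>W\<close>.\<close>

lemma aequiv_iff_fequiv:
  assumes x: "adatum_W X x" and y: "adatum_W Y y"
  shows "aequiv X x Y y \<longleftrightarrow> fequiv X (fcan x) Y (fcan y)"
proof
  have xy: "adatum X x" "adatum Y y" using x y by (auto simp: adatum_W_def)
  note fW = fdatum_W_fcan[OF x] fdatum_W_fcan[OF y]
  {
    assume "aequiv X x Y y"
    then obtain u u' where u: "u \<in> W" "u \<in> mor C" "u' \<in> mor C" "trg C u = X" "trg C u' = Y" "src C u' = src C u"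
      and i: "aiso (src C u) (arestrict x u) (arestrict y u')"
      by (auto simp: aequiv_def hom_iff)
    have "fiso (src C u) (frestrict (fcan x) u) (frestrict (fcan y) u')"
      using aiso_imp_fiso_fcan[OF i] fiso_fcan_arestrict[OF xy(1), of u "src C u"]
        fiso_fcan_arestrict[OF xy(2), of u' "src C u"] u
      by (auto intro: fiso_trans fiso_sym)
    moreover have "w1 \<odot> leg (fcan x) \<odot> u \<in> W"
      using fW(1) fdatum_leg[of X "fcan x"] u W_comp1[of u "w1 \<odot> leg (fcan x)"] by (simp add: fdatum_W_def)
    ultimately show "fequiv X (fcan x) Y (fcan y)" using fW u by (intro fequivI) auto
  }
  {
    assume "fequiv X (fcan x) Y (fcan y)"
    then obtain z z' where z: "z \<in> W" "z' \<in> mor C" "trg C z = X" "trg C z' = Y" "src C z' = src C z"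
      and i: "fiso (src C z) (frestrict (fcan x) z) (frestrict (fcan y) z')"
      by (rule fequivE)
    note [simp] = z
    have a: "adatum (src C z) (arestrict x z)" "adatum (src C z) (arestrict y z')"
      using adatum_arestrict[OF xy(1), of z "src C z"] adatum_arestrict[OF xy(2), of z' "src C z"] by auto
    have "fiso (src C z) (fcan (arestrict x z)) (fcan (arestrict y z'))"
      using i fiso_fcan_arestrict[OF xy(1), of z "src C z"] fiso_fcan_arestrict[OF xy(2), of z' "src C z"]
      by (auto intro: fiso_trans fiso_sym)
    then obtain r where r: "r \<in> W" "trg C r = src C z"
      "aiso (src C r) (arestrict (arestrict x z) r) (arestrict (arestrict y z') r)"
      by (rule fiso_fcan_imp_aiso[OF a])
    have "aiso (src C r) (arestrict x (z \<odot> r)) (arestrict y (z' \<odot> r))"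
      using r aiso_arestrict_comp1[OF xy(1), of z r "src C r"] aiso_arestrict_comp1[OF xy(2), of z' r "src C r"]
      by (auto intro: aiso_trans aiso_sym)
    then show "aequiv X x Y y" unfolding aequiv_def using x y r
      by (intro conjI exI[of _ "src C r"] exI[of _ "z \<odot> r"] exI[of _ "z' \<odot> r"]) (auto simp: hom_iff)
  }
qed

text \<open>The first leg is made to factor through \<open>p\<close> by a square over
  \<open>w1\<close>. After whiskering with \<open>w2\<close>, the second leg is then linked to
  \<open>q\<close> through \<open>\<alpha>\<close> and \<open>\<tau>\<close>; this link is lifted
  along \<open>w2\<close>, and \<open>\<beta>\<close> is transported along the resulting isomorphism
  of legs.\<close>

lemma fcan_surjective:
  assumes "fdatum_W X d"
  obtains Y x where "adatum_W Y x" "fequiv Y (fcan x) X d"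
proof -
  obtain v1 v2 \<alpha> \<beta> where d: "d = (v1, v2, \<alpha>, \<beta>)" by (metis prod_cases4)
  have D: "datum w1 w2 X v1 v2 \<alpha>" "datum f1 f2 X v1 v2 \<beta>" "invertible2 \<alpha>" "w1 \<odot> v1 \<in> W" "fdatum X d"
    using assms by (auto simp: fdatum_W_def fdatum_def d)
  have v: "v1 \<in> mor C" "v2 \<in> mor C" "src C v1 = X" "src C v2 = X" "trg C v1 = A1" "trg C v2 = A2"
    "\<alpha> \<in> cell C" "dom2 C \<alpha> = w1 \<odot> v1" "cod2 C \<alpha> = w2 \<odot> v2"
    using D(1) by (auto simp: datum_def)
  note [simp] = v D(3,4)
  obtain m k \<rho> where m: "m \<in> W" "k \<in> mor C" "trg C m = X" "trg C k = E" "src C k = src C m"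
    and \<rho>: "invertible2 \<rho>" "dom2 C \<rho> = v1 \<odot> m" "cod2 C \<rho> = p \<odot> k"
    by (rule ore_over_W[of w1 v1 p]) auto
  note [simp] = m \<rho> invertible2_cell[OF \<rho>(1)]
  \<comment> \<open>The path from \<open>w2 \<odot> (v2 \<odot> m)\<close> back through
    \<open>\<alpha>\<close> to the first leg, across \<open>\<rho>\<close>, and forward through
    \<open>\<tau>\<close> to \<open>w2 \<odot> (q \<odot> k)\<close>.\<close>
  define \<gamma> where "\<gamma> = rwhisker_assoc C w1 p w2 q \<tau> k \<bullet> ((w1 \<triangleright> \<rho>) \<bullet> inv2 C (rwhisker_assoc C w1 v1 w2 v2 \<alpha> m))"
  have \<gamma>: "\<gamma> \<in> cell C" "invertible2 \<gamma>" "dom2 C \<gamma> = w2 \<odot> (v2 \<odot> m)" "cod2 C \<gamma> = w2 \<odot> (q \<odot> k)"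
    by (simp_all add: \<gamma>_def)
  note [simp] = \<gamma>
  obtain v \<kappa> where v: "v \<in> W" "trg C v = src C m"
    and \<kappa>: "invertible2 \<kappa>" "dom2 C \<kappa> = v2 \<odot> m \<odot> v" "cod2 C \<kappa> = q \<odot> k \<odot> v"
    and eq: "rwhisker_assoc C w2 (v2 \<odot> m) w2 (q \<odot> k) \<gamma> v = w2 \<triangleright> \<kappa>"
    by (rule lift_along_W[of w2 "v2 \<odot> m" "q \<odot> k" \<gamma>]) auto
  note [simp] = v \<kappa> invertible2_cell[OF \<kappa>(1)]
  \<comment> \<open>The definition of \<open>\<gamma>\<close> solved for the restriction of
    \<open>\<tau>\<close>. Restricting this equation along \<open>v\<close> replaces
    \<open>\<gamma>\<close> by \<open>w2 \<triangleright> \<kappa>\<close>, the shape that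
    \<open>datum_iso\<close> demands.\<close>
  have "\<gamma> \<bullet> (rwhisker_assoc C w1 v1 w2 v2 \<alpha> m \<bullet> (w1 \<triangleright> inv2 C \<rho>)) = rwhisker_assoc C w1 p w2 q \<tau> k"
    by (simp add: \<gamma>_def lwhisker_vcomp[symmetric])
  then have "rwhisker_assoc C w1 (p \<odot> k) w2 (q \<odot> k) (rwhisker_assoc C w1 p w2 q \<tau> k) v =
      rwhisker_assoc C w2 (v2 \<odot> m) w2 (q \<odot> k) \<gamma> v \<bullet>
      (rwhisker_assoc C w1 (v1 \<odot> m) w2 (v2 \<odot> m) (rwhisker_assoc C w1 v1 w2 v2 \<alpha> m) v \<bullet>
        rwhisker_assoc C w1 (p \<odot> k) w1 (v1 \<odot> m) (w1 \<triangleright> inv2 C \<rho>) v)"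
    by (simp add: rwhisker_assoc_vcomp[symmetric])
  also have "rwhisker_assoc C w1 (p \<odot> k) w1 (v1 \<odot> m) (w1 \<triangleright> inv2 C \<rho>) v = w1 \<triangleright> (inv2 C \<rho> \<triangleleft> v)"
    by (rule rwhisker_assoc_lwhisker) auto
  finally have i: "datum_iso w1 w2 (src C v) (v1 \<odot> m \<odot> v) (v2 \<odot> m \<odot> v)
      (rwhisker_assoc C w1 (v1 \<odot> m) w2 (v2 \<odot> m) (rwhisker_assoc C w1 v1 w2 v2 \<alpha> m) v)
      (p \<odot> k \<odot> v) (q \<odot> k \<odot> v) (rwhisker_assoc C w1 (p \<odot> k) w2 (q \<odot> k) (rwhisker_assoc C w1 p w2 q \<tau> k) v)
      (inv2 C \<rho> \<triangleleft> v) \<kappa>"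
    by (simp add: datum_iso_def datum_def eq)
  have c: "datum_iso w1 w2 (src C v) (v1 \<odot> m \<odot> v) (v2 \<odot> m \<odot> v)
      (rwhisker_assoc C w1 (v1 \<odot> m) w2 (v2 \<odot> m) (rwhisker_assoc C w1 v1 w2 v2 \<alpha> m) v)
      (v1 \<odot> (m \<odot> v)) (v2 \<odot> (m \<odot> v)) (rwhisker_assoc C w1 v1 w2 v2 \<alpha> (m \<odot> v))
      (inv2 C (assoc C v1 m v)) (assoc C v2 m v)"
    by (rule datum_iso_restrict_comp1[OF D(1)]) auto
  have c': "datum_iso w1 w2 (src C v) (p \<odot> k \<odot> v) (q \<odot> k \<odot> v)
      (rwhisker_assoc C w1 (p \<odot> k) w2 (q \<odot> k) (rwhisker_assoc C w1 p w2 q \<tau> k) v)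
      (p \<odot> (k \<odot> v)) (q \<odot> (k \<odot> v)) (rwhisker_assoc C w1 p w2 q \<tau> (k \<odot> v))
      (inv2 C (assoc C p k v)) (assoc C q k v)"
    by (rule datum_iso_restrict_comp1[OF datum_choice]) auto
  obtain \<sigma>1 \<sigma>2 where \<sigma>: "datum_iso w1 w2 (src C v) (v1 \<odot> (m \<odot> v)) (v2 \<odot> (m \<odot> v))
      (rwhisker_assoc C w1 v1 w2 v2 \<alpha> (m \<odot> v))
      (p \<odot> (k \<odot> v)) (q \<odot> (k \<odot> v)) (rwhisker_assoc C w1 p w2 q \<tau> (k \<odot> v)) \<sigma>1 \<sigma>2"
    using datum_iso_trans[OF datum_iso_trans[OF datum_iso_sym[OF c] i] c'] by blast
  define \<phi> where "\<phi> = (f2 \<triangleright> \<sigma>2) \<bullet> (rwhisker_assoc C f1 v1 f2 v2 \<beta> (m \<odot> v) \<bullet> (f1 \<triangleright> \<sigma>1))"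
  have j: "datum_iso f1 f2 (src C v) (v1 \<odot> (m \<odot> v)) (v2 \<odot> (m \<odot> v))
      (rwhisker_assoc C f1 v1 f2 v2 \<beta> (m \<odot> v)) (p \<odot> (k \<odot> v)) (q \<odot> (k \<odot> v)) \<phi> \<sigma>1 \<sigma>2"
    unfolding \<phi>_def
    by (rule datum_iso_transport[OF datum_restrict[OF D(2)]]) (use \<sigma> in \<open>auto simp: datum_iso_def\<close>)
  define x where "x = (k \<odot> v, \<phi>)"
  have x: "adatum (src C v) x" using j by (auto simp: adatum_def x_def datum_iso_def hom_iff)
  have fx: "fiso (src C v) (frestrict d (m \<odot> v)) (fcan x)"
    using \<sigma> j by (auto simp: fiso_def frestrict_def d fcan_def x_def)
  \<comment> \<open>So far \<open>k \<odot> v\<close> is not known to be in \<open>W\<close>, only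
    to become so after composition with \<open>w1 \<odot> p\<close>; a last restriction along
    \<open>s\<close> repairs this.\<close>
  have "w1 \<odot> (v1 \<odot> (m \<odot> v)) \<in> W" using W_assoc[of "m \<odot> v" v1 w1] by simp
  then have "w1 \<odot> (p \<odot> (k \<odot> v)) \<in> W"
    using fiso_leg_W[OF fx] by (simp add: d fcan_def x_def)
  then have "w1 \<odot> p \<odot> (k \<odot> v) \<in> W" using W_assoc[of "k \<odot> v" p w1] by simp
  then obtain s where s: "s \<in> mor C" "trg C s = src C v" "k \<odot> v \<odot> s \<in> W"
    by (rule right_factor_into_W[of "w1 \<odot> p" "k \<odot> v", rotated 3]) auto
  note [simp] = s
  have y: "adatum_W (src C s) (arestrict x s)"
    using adatum_arestrict[OF x, of s] by (auto simp: adatum_W_def arestrict_def x_def)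
  have f: "fiso (src C s) (fcan (arestrict x s)) (frestrict d (m \<odot> v \<odot> s))"
    using fiso_fcan_arestrict[OF x, of s] fiso_frestrict[OF fx, of s]
      fiso_frestrict_comp1[OF D(5), of "m \<odot> v" s]
    by simp (blast intro: fiso_trans fiso_sym)
  have W: "w1 \<odot> leg (fcan (arestrict x s)) \<in> W" using fdatum_W_fcan[OF y] by (simp add: fdatum_W_def)
  have "w1 \<odot> v1 \<odot> (m \<odot> v \<odot> s) \<in> W"
    using fiso_leg_W[OF f] W W_assoc[of "m \<odot> v \<odot> s" v1 w1] by (simp add: d)
  then have "fequiv (src C s) (frestrict d (m \<odot> v \<odot> s)) X d"
    using fequiv_frestrict[OF assms, of "m \<odot> v \<odot> s"] by (simp add: d)
  then show ?thesis using that[OF y] fequiv_trans[OF fiso_imp_fequiv[OF f W]] by blast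
qed

section \<open>Matching with the given sets and relations of almost canonical
  representatives\<close>

lemma acr_data_iff:
  "(X, x) \<in> acr_data C W (E, p, q, \<tau>) (A1, w1, f1) (A2, w2, f2) \<longleftrightarrow> adatum_W X x"
  by (cases x) (auto simp: adatum_W_def adatum_def datum_def hom_iff hom2_iff)

text \<open>The given equation uses the bracketing \<open>(p \<odot> t) \<odot> u\<close>, whereas
  \<open>aiso\<close> uses \<open>p \<odot> (t \<odot> u)\<close>. Conjugating with the rebracketing
  isomorphisms on both sides translates either into the other.\<close>

lemma lwhisker_assoc_iff:
  assumes "adatum X (t, \<phi>)" "adatum Y (t', \<phi>')" "u \<in> hom C Z X" "u' \<in> hom C Z Y"
    "\<sigma> \<in> iso2 C (t' \<odot> u') (t \<odot> u)"
  shows "(f2 \<triangleright> lwhisker_assoc C q t u t' u' (inv2 C \<sigma>)) \<bullet>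
      rwhisker_assoc C f1 (p \<odot> t) f2 (q \<odot> t) \<phi> u \<bullet> (f1 \<triangleright> lwhisker_assoc C p t' u' t u \<sigma>) =
      rwhisker_assoc C f1 (p \<odot> t') f2 (q \<odot> t') \<phi>' u' \<longleftrightarrow>
    datum_iso f1 f2 Z (p \<odot> (t \<odot> u)) (q \<odot> (t \<odot> u)) (rwhisker_inner f1 p f2 q t \<phi> u)
      (p \<odot> (t' \<odot> u')) (q \<odot> (t' \<odot> u')) (rwhisker_inner f1 p f2 q t' \<phi>' u') (p \<triangleright> \<sigma>) (q \<triangleright> inv2 C \<sigma>)"
    (is "?eq \<longleftrightarrow> ?iso")
proof -
  have t: "t \<in> mor C" "src C t = X" "trg C t = E" "t' \<in> mor C" "src C t' = Y" "trg C t' = E"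
    and D: "datum f1 f2 X (p \<odot> t) (q \<odot> t) \<phi>" "datum f1 f2 Y (p \<odot> t') (q \<odot> t') \<phi>'"
    using assms(1,2) by (auto simp: adatum_def hom_iff)
  have u: "u \<in> mor C" "trg C u = X" "src C u = Z" "u' \<in> mor C" "trg C u' = Y" "src C u' = Z"
    "invertible2 \<sigma>" "dom2 C \<sigma> = t' \<odot> u'" "cod2 C \<sigma> = t \<odot> u" "\<sigma> \<in> cell C"
    using assms(3-) by (auto simp: hom_iff iso2_iff)
  note [simp] = t u
  note i = datum_iso_rwhisker_inner[OF D(1), of u Z] datum_iso_rwhisker_inner[OF D(2), of u' Z]
  have r: "datum f1 f2 Z (p \<odot> t \<odot> u) (q \<odot> t \<odot> u) (rwhisker_assoc C f1 (p \<odot> t) f2 (q \<odot> t) \<phi> u)"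
    "datum f1 f2 Z (p \<odot> t' \<odot> u') (q \<odot> t' \<odot> u') (rwhisker_assoc C f1 (p \<odot> t') f2 (q \<odot> t') \<phi>' u')"
    using D datum_restrict by simp_all
  have lw: "lwhisker_assoc C p t' u' t u \<sigma> = inv2 C (assoc C p t u) \<bullet> ((p \<triangleright> \<sigma>) \<bullet> assoc C p t' u')"
    "lwhisker_assoc C q t u t' u' (inv2 C \<sigma>) =
      inv2 C (assoc C q t' u') \<bullet> ((q \<triangleright> inv2 C \<sigma>) \<bullet> assoc C q t u)"
    by (simp_all add: lwhisker_assoc_def)
  let ?lw = "datum_iso f1 f2 Z (p \<odot> t \<odot> u) (q \<odot> t \<odot> u) (rwhisker_assoc C f1 (p \<odot> t) f2 (q \<odot> t) \<phi> u)
    (p \<odot> t' \<odot> u') (q \<odot> t' \<odot> u') (rwhisker_assoc C f1 (p \<odot> t') f2 (q \<odot> t') \<phi>' u')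
    (lwhisker_assoc C p t' u' t u \<sigma>) (lwhisker_assoc C q t u t' u' (inv2 C \<sigma>))"
  have "?eq \<longleftrightarrow> ?lw"
    using datum_iso_iff[OF r] by (simp add: lw iso2_iff)
  also have "\<dots> \<longleftrightarrow> ?iso"
  proof
    assume L: ?lw
    show ?iso
      using datum_iso_trans[OF datum_iso_trans[OF datum_iso_sym[OF i(1)] L] i(2)] by (simp add: lw)
  next
    assume L: ?iso
    show ?lw
      using datum_iso_trans[OF datum_iso_trans[OF i(1) L] datum_iso_sym[OF i(2)]] by (simp add: lw)
  qed
  finally show ?thesis .
qed

lemma acr_equiv_iff:
  "((X, x), (Y, y)) \<in> acr_equiv C W (E, p, q, \<tau>) (A1, w1, f1) (A2, w2, f2) \<longleftrightarrow> aequiv X x Y y"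
proof -
  obtain t \<phi> t' \<phi>' where xy: "x = (t, \<phi>)" "y = (t', \<phi>')" by (metis surj_pair)
  have "((X, x), (Y, y)) \<in> acr_equiv C W (E, p, q, \<tau>) (A1, w1, f1) (A2, w2, f2) \<longleftrightarrow>
    (X, x) \<in> acr_data C W (E, p, q, \<tau>) (A1, w1, f1) (A2, w2, f2) \<and>
    (Y, y) \<in> acr_data C W (E, p, q, \<tau>) (A1, w1, f1) (A2, w2, f2) \<and>
    (\<exists>Z u u' \<sigma>. u \<in> W \<and> u \<in> hom C Z X \<and> u' \<in> hom C Z Y \<and> \<sigma> \<in> iso2 C (t' \<odot> u') (t \<odot> u) \<and>
      (f2 \<triangleright> lwhisker_assoc C q t u t' u' (inv2 C \<sigma>)) \<bullet>
      rwhisker_assoc C f1 (p \<odot> t) f2 (q \<odot> t) \<phi> u \<bullet> (f1 \<triangleright> lwhisker_assoc C p t' u' t u \<sigma>) =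
      rwhisker_assoc C f1 (p \<odot> t') f2 (q \<odot> t') \<phi>' u')"
    unfolding xy by (simp only: acr_equiv.simps mem_Collect_eq case_prod_conv)
  also have "\<dots> \<longleftrightarrow> aequiv X x Y y"
    unfolding acr_data_iff aequiv_def
  proof (intro conj_cong refl iff_exI)
    fix Z u u' assume "adatum_W X x" "adatum_W Y y"
    then have D: "adatum X x" "adatum Y y" by (simp_all add: adatum_W_def)
    have "(\<exists>\<sigma>. \<sigma> \<in> iso2 C (t' \<odot> u') (t \<odot> u) \<and>
      (f2 \<triangleright> lwhisker_assoc C q t u t' u' (inv2 C \<sigma>)) \<bullet>
      rwhisker_assoc C f1 (p \<odot> t) f2 (q \<odot> t) \<phi> u \<bullet> (f1 \<triangleright> lwhisker_assoc C p t' u' t u \<sigma>) =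
      rwhisker_assoc C f1 (p \<odot> t') f2 (q \<odot> t') \<phi>' u') \<longleftrightarrow> aiso Z (arestrict x u) (arestrict y u')"
      if u: "u \<in> hom C Z X" "u' \<in> hom C Z Y"
    proof -
      have "adatum Z (arestrict x u)" "adatum Z (arestrict y u')"
        using adatum_arestrict[OF D(1), of u Z] adatum_arestrict[OF D(2), of u' Z] u by (auto simp: hom_iff)
      then have "aiso Z (arestrict x u) (arestrict y u') \<longleftrightarrow> (\<exists>\<sigma>. \<sigma> \<in> iso2 C (t' \<odot> u') (t \<odot> u) \<and>
        datum_iso f1 f2 Z (p \<odot> (t \<odot> u)) (q \<odot> (t \<odot> u)) (rwhisker_inner f1 p f2 q t \<phi> u)
      (p \<odot> (t' \<odot> u')) (q \<odot> (t' \<odot> u')) (rwhisker_inner f1 p f2 q t' \<phi>' u') (p \<triangleright> \<sigma>) (q \<triangleright> inv2 C \<sigma>))"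
        unfolding aiso_def arestrict_def xy iso2_iff case_prod_conv using invertible2_cell by blast
      then show ?thesis using lwhisker_assoc_iff[OF D[unfolded xy] u] by blast
    qed
    then show "(\<exists>\<sigma>. u \<in> W \<and> u \<in> hom C Z X \<and> u' \<in> hom C Z Y \<and> \<sigma> \<in> iso2 C (t' \<odot> u') (t \<odot> u) \<and>
      (f2 \<triangleright> lwhisker_assoc C q t u t' u' (inv2 C \<sigma>)) \<bullet>
      rwhisker_assoc C f1 (p \<odot> t) f2 (q \<odot> t) \<phi> u \<bullet> (f1 \<triangleright> lwhisker_assoc C p t' u' t u \<sigma>) =
      rwhisker_assoc C f1 (p \<odot> t') f2 (q \<odot> t') \<phi>' u') \<longleftrightarrow>
      u \<in> W \<and> u \<in> hom C Z X \<and> u' \<in> hom C Z Y \<and> aiso Z (arestrict x u) (arestrict y u')"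
      by blast
  qed
  finally show ?thesis .
qed

end

text \<open>\<open>S\<close> is the pullback of \<open>R\<close> along \<open>f\<close>, so
  \<open>f\<close> induces an injection on classes; the last hypothesis says that its image meets
  every class of \<open>R\<close>.\<close>

lemma bij_betw_quotient_map:
  assumes R: "equiv A R" and f: "\<And>x. x \<in> B \<Longrightarrow> f x \<in> A"
    and S: "\<And>x y. (x, y) \<in> S \<longleftrightarrow> x \<in> B \<and> y \<in> B \<and> (f x, f y) \<in> R"
    and surj: "\<And>a. a \<in> A \<Longrightarrow> \<exists>x\<in>B. (f x, a) \<in> R"
  shows "\<exists>N. bij_betw N (B // S) (A // R) \<and> (\<forall>x\<in>B. N (S `` {x}) = R `` {f x})"
proof (intro exI conjI ballI)
  \<comment> \<open>Taking the image of a whole class and saturating it under \<open>R\<close>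
    defines the map without choosing representatives.\<close>
  let ?N = "\<lambda>c. R `` (f ` c)"
  show N: "?N (S `` {x}) = R `` {f x}" if "x \<in> B" for x
  proof -
    have "(f x, f x) \<in> R" using R f that by (auto simp: equiv_def refl_on_def)
    then show ?thesis using R that by (auto simp: S equiv_def dest: symD transD)
  qed
  show "bij_betw ?N (B // S) (A // R)"
  proof (rule bij_betw_imageI)
    show "inj_on ?N (B // S)"
    proof (rule inj_onI)
      fix c c' assume c: "c \<in> B // S" "c' \<in> B // S" and eq: "?N c = ?N c'"
      then obtain x y where x: "x \<in> B" "c = S `` {x}" and y: "y \<in> B" "c' = S `` {y}" by (auto elim!: quotientE)
      have "R `` {f x} = R `` {f y}" using eq N x y by simp
      then show "c = c'" using x y by (auto simp: S set_eq_iff)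
    qed
    show "?N ` (B // S) = A // R"
    proof
      show "?N ` (B // S) \<subseteq> A // R" using N f by (auto elim!: quotientE intro!: quotientI)
      show "A // R \<subseteq> ?N ` (B // S)"
      proof
        fix c assume "c \<in> A // R"
        then obtain a where a: "a \<in> A" "c = R `` {a}" by (auto elim: quotientE)
        obtain x where x: "x \<in> B" "(f x, a) \<in> R" using surj[OF a(1)] by blast
        have "c = ?N (S `` {x})" unfolding N[OF x(1)] a(2) using equiv_class_eq[OF R x(2)] by simp
        then show "c \<in> ?N ` (B // S)" using x(1) by (blast intro: quotientI)
      qed
    qed
  qed
qed

theorem proposition9p3:
  fixes C :: "('o, 'm, 'c) bicat"
    and W :: "'m set"
    and CW :: "'m \<Rightarrow> 'm \<Rightarrow> 'o \<times> 'm \<times> 'm \<times> 'c"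
    and A B A1 A2 E :: 'o
    and w1 f1 w2 f2 p q :: 'm
    and \<tau> :: 'c
  assumes "bicategory_BF C W"
    and "choices C W CW"
    and "(A1, w1, f1) \<in> frac_hom C W A B"
    and "(A2, w2, f2) \<in> frac_hom C W A B"
    and "CW w1 w2 = (E, p, q, \<tau>)"
  shows "\<exists>N.
    bij_betw N
      (acr_data C W (E, p, q, \<tau>) (A1, w1, f1) (A2, w2, f2) //
        acr_equiv C W (E, p, q, \<tau>) (A1, w1, f1) (A2, w2, f2))
      (frac_hom2 C W (A1, w1, f1) (A2, w2, f2)) \<and>
    (\<forall>A3 t \<phi>. (A3, t, \<phi>) \<in> acr_data C W (E, p, q, \<tau>) (A1, w1, f1) (A2, w2, f2) \<longrightarrow>
      N (acr_equiv C W (E, p, q, \<tau>) (A1, w1, f1) (A2, w2, f2) `` {(A3, t, \<phi>)}) =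
      frac_equiv C W (A1, w1, f1) (A2, w2, f2) ``
        {(A3, p \<odot>\<^bsub>C\<^esub> t, q \<odot>\<^bsub>C\<^esub> t, rwhisker_assoc C w1 p w2 q \<tau> t, \<phi>)})"
proof -
  have "w1 \<in> W" "w1 \<in> hom C A1 A" "w2 \<in> W" "w2 \<in> hom C A2 A"
    using assms(3,4) by (auto simp: frac_hom_def)
  \<comment> \<open>In this choice \<open>w1\<close> is the arbitrary morphism and \<open>w2\<close>
    the one from \<open>W\<close>; that is why \<open>p\<close> is in \<open>W\<close> while
    \<open>q\<close> is just a morphism.\<close>
  then have c: "p \<in> W" "p \<in> hom C E A1" "q \<in> hom C E A2" "\<tau> \<in> iso2 C (w1 \<odot>\<^bsub>C\<^esub> p) (w2 \<odot>\<^bsub>C\<^esub> q)"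
    using assms(2,5) unfolding choices_def by fastforce+
  interpret frac_choice C W A B A1 A2 w1 f1 w2 f2 E p q \<tau>
    using assms(1,3,4) c by (intro frac_choice.intro frac_pair.intro frac_pair_axioms.intro frac_choice_axioms.intro)
  let ?f = "\<lambda>(X, x). (X, fcan x)"
  have "\<exists>N. bij_betw N
      (acr_data C W (E, p, q, \<tau>) (A1, w1, f1) (A2, w2, f2) //
        acr_equiv C W (E, p, q, \<tau>) (A1, w1, f1) (A2, w2, f2))
      (frac_data C W (A1, w1, f1) (A2, w2, f2) // frac_equiv C W (A1, w1, f1) (A2, w2, f2)) \<and>
    (\<forall>x \<in> acr_data C W (E, p, q, \<tau>) (A1, w1, f1) (A2, w2, f2).
      N (acr_equiv C W (E, p, q, \<tau>) (A1, w1, f1) (A2, w2, f2) `` {x}) =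
      frac_equiv C W (A1, w1, f1) (A2, w2, f2) `` {?f x})"
  proof (rule bij_betw_quotient_map[OF equiv_frac_equiv])
    fix x assume "x \<in> acr_data C W (E, p, q, \<tau>) (A1, w1, f1) (A2, w2, f2)"
    then show "?f x \<in> frac_data C W (A1, w1, f1) (A2, w2, f2)"
      by (cases x) (simp only: acr_data_iff frac_data_iff prod.case fdatum_W_fcan)
  next
    fix x y :: "'o \<times> 'm \<times> 'c"
    obtain X x' Y y' where xy: "x = (X, x')" "y = (Y, y')" by (metis surj_pair)
    show "(x, y) \<in> acr_equiv C W (E, p, q, \<tau>) (A1, w1, f1) (A2, w2, f2) \<longleftrightarrow>
      x \<in> acr_data C W (E, p, q, \<tau>) (A1, w1, f1) (A2, w2, f2) \<and>
      y \<in> acr_data C W (E, p, q, \<tau>) (A1, w1, f1) (A2, w2, f2) \<and>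
      (?f x, ?f y) \<in> frac_equiv C W (A1, w1, f1) (A2, w2, f2)"
      unfolding xy prod.case acr_equiv_iff acr_data_iff frac_equiv_iff
      using aequiv_iff_fequiv aequiv_def by blast
  next
    fix d assume "d \<in> frac_data C W (A1, w1, f1) (A2, w2, f2)"
    then obtain X d' where d: "d = (X, d')" "fdatum_W X d'" using frac_data_iff by (metis surj_pair)
    obtain Y y where "adatum_W Y y" "fequiv Y (fcan y) X d'" by (rule fcan_surjective[OF d(2)])
    then show "\<exists>x\<in>acr_data C W (E, p, q, \<tau>) (A1, w1, f1) (A2, w2, f2).
        (?f x, d) \<in> frac_equiv C W (A1, w1, f1) (A2, w2, f2)"
      by (intro bexI[of _ "(Y, y)"]) (simp_all only: d(1) prod.case acr_data_iff frac_equiv_iff)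
  qed
  then show ?thesis
    by (fastforce simp only: frac_hom2_def fcan_def prod.case)
qed

end
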